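(* Let $\mathfrak g$ and $\mathfrak g'$ be solvable singular quadratic Lie algebras and let $\mathfrak g_N,\mathfrak g_I$ and $\mathfrak g'_N,\mathfrak g'_I$ be their respective nilpotent and invertible Fitting components. Then $\mathfrak g$ is i-isomorphic to $\mathfrak g'$ if and only if $\mathfrak g_N$ is i-isomorphic to $\mathfrak g'_N$ and $\mathfrak g_I$ is i-isomorphic to $\mathfrak g'_I$. The result remains valid if i-isomorphism is replaced throughout by isomorphism of Lie algebras.
   Context: All vector spaces are finite-dimensional over $\mathbb C$. A quadratic Lie algebra $(\mathfrak g,B)$ is a Lie algebra with a non-degenerate symmetric invariant bilinear form ($B([X,Y],Z)=B(X,[Y,Z])$). An i-isomorphism is a Lie algebra isomorphism that is an isometry for the given forms. Let $I(X,Y,Z)=B([X,Y],Z)$ and $\mathrm{dup}(\mathfrak g)=\dim\{\alpha\in\mathfrak g^*\mid\alpha\wedge I=0\}$; a non-Abelian quadratic Lie algebra is singular if $\mathrm{dup}(\mathfrak g)\ge1$. Double extension of a quadratic vector space $(\mathfrak q,B_{\mathfrak q})$ (non-degenerate symmetric form) by a skew-symmetric map $\overline C$ of $\mathfrak q$: the orthogonal direct sum $(\mathbb CX_0\oplus\mathbb CY_0)\oplus\mathfrak q$, with form $B$ extending $B_{\mathfrak q}$ and $B(X_0,X_0)=B(Y_0,Y_0)=0$, $B(X_0,Y_0)=1$, and bracket $[X+\lambda X_0+\mu Y_0,\,Y+\lambda'X_0+\mu'Y_0]=\mu\overline C(Y)-\mu'\overline C(X)+B(\overline C(X),Y)X_0$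 for $X,Y\in\mathfrak q$. Every solvable singular quadratic Lie algebra can be realized as a double extension $\mathfrak g=(\mathbb CX_0\oplus\mathbb CY_0)\oplus\mathfrak q$ by $\overline C=\mathrm{ad}(Y_0)|_{\mathfrak q}$. Fitting components: fix such a realization of $\mathfrak g$ and let $\mathfrak q=\mathfrak q_N\oplus\mathfrak q_I$ be the Fitting decomposition of $\overline C$ ($\mathfrak q_N,\mathfrak q_I$ are $\overline C$-stable, $\overline C_N=\overline C|_{\mathfrak q_N}$ nilpotent, $\overline C_I=\overline C|_{\mathfrak q_I}$ invertible). These subspaces are orthogonal to each other, so $\overline C_N$ and $\overline C_I$ are skew-symmetric on the quadratic vector spaces $\mathfrak q_N,\mathfrak q_I$. The nilpotent Fitting component is $\mathfrak g_N=(\mathbb CX_0\oplus\mathbb CY_0)\oplus\mathfrak q_N$, the double extension of $\mathfrak q_N$ by $\overline C_N$, and the invertible Fitting component is $\mathfrak g_I=(\mathbb CX_0\oplus\mathbb CY_0)\oplus\mathfrak q_I$, the double extension of $\mathfrak q_I$ by $\overline C_I$; both carry the restriction of $B$. The components of $\mathfrak g'$ are defined in the same way from a fixed realization of $\mathfrak g'$. *)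

theory Defs
  imports "HOL-Analysis.Analysis" "HOL-Library.Function_Algebras"
begin

text \<open>All structures live on carrier sets \<open>V\<close> inside an ambient complex vector space with scalar
  multiplication \<open>s\<close>, so that subspaces such as the Fitting components carry the restricted bracket
  and form without changing the underlying functions. Brackets, forms and linear maps are only
  constrained on carriers.\<close>

definition linear_on ::
  "(complex \<Rightarrow> 'a::ab_group_add \<Rightarrow> 'a) \<Rightarrow> (complex \<Rightarrow> 'b::ab_group_add \<Rightarrow> 'b) \<Rightarrow> 'a set \<Rightarrow> ('a \<Rightarrow> 'b) \<Rightarrow> bool"
  where "linear_on s s' V f \<longleftrightarrow>
    (\<forall>x\<in>V. \<forall>y\<in>V. f (x + y) = f x + f y) \<and> (\<forall>c. \<forall>x\<in>V. f (s c x) = s' c (f x))"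

definition bilinear_on ::
  "(complex \<Rightarrow> 'a::ab_group_add \<Rightarrow> 'a) \<Rightarrow> (complex \<Rightarrow> 'b::ab_group_add \<Rightarrow> 'b) \<Rightarrow> 'a set
    \<Rightarrow> ('a \<Rightarrow> 'a \<Rightarrow> 'b) \<Rightarrow> bool"
  where "bilinear_on s s' V f \<longleftrightarrow>
    (\<forall>x\<in>V. linear_on s s' V (\<lambda>y. f x y)) \<and> (\<forall>y\<in>V. linear_on s s' V (\<lambda>x. f x y))"

locale fin_dim_space = vector_space s
  for s :: "complex \<Rightarrow> 'a::ab_group_add \<Rightarrow> 'a" +
  fixes V :: "'a set"
  assumes fin_dim: "\<exists>S. finite S \<and> V = span S"

locale quadratic_space = fin_dim_space s V
  for s :: "complex \<Rightarrow> 'a::ab_group_add \<Rightarrow> 'a" and V +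
  fixes B :: "'a \<Rightarrow> 'a \<Rightarrow> complex"
  assumes form_bilinear: "bilinear_on s (*) V B"
    and form_sym: "\<lbrakk>x \<in> V; y \<in> V\<rbrakk> \<Longrightarrow> B x y = B y x"
    and form_nondegenerate: "\<lbrakk>x \<in> V; \<And>y. y \<in> V \<Longrightarrow> B x y = 0\<rbrakk> \<Longrightarrow> x = 0"

locale lie_algebra = fin_dim_space s V
  for s :: "complex \<Rightarrow> 'a::ab_group_add \<Rightarrow> 'a" and V +
  fixes br :: "'a \<Rightarrow> 'a \<Rightarrow> 'a"
  assumes br_closed: "\<lbrakk>x \<in> V; y \<in> V\<rbrakk> \<Longrightarrow> br x y \<in> V"
    and br_bilinear: "bilinear_on s s V br"
    and br_alternating: "x \<in> V \<Longrightarrow> br x x = 0"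
    and jacobi: "\<lbrakk>x \<in> V; y \<in> V; z \<in> V\<rbrakk> \<Longrightarrow> br x (br y z) + br y (br z x) + br z (br x y) = 0"

locale quadratic_lie_algebra = lie_algebra s V br + quadratic_space s V B
  for s :: "complex \<Rightarrow> 'a::ab_group_add \<Rightarrow> 'a" and V br B +
  assumes form_invariant: "\<lbrakk>x \<in> V; y \<in> V; z \<in> V\<rbrakk> \<Longrightarrow> B (br x y) z = B x (br y z)"

fun derived_series ::
  "(complex \<Rightarrow> 'a::ab_group_add \<Rightarrow> 'a) \<Rightarrow> 'a set \<Rightarrow> ('a \<Rightarrow> 'a \<Rightarrow> 'a) \<Rightarrow> nat \<Rightarrow> 'a set"
  where
    "derived_series s V br 0 = V"
  | "derived_series s V br (Suc n) =
       module.span s {br x y | x y. x \<in> derived_series s V br n \<and> y \<in> derived_series s V br n}"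

definition solvable_lie ::
  "(complex \<Rightarrow> 'a::ab_group_add \<Rightarrow> 'a) \<Rightarrow> 'a set \<Rightarrow> ('a \<Rightarrow> 'a \<Rightarrow> 'a) \<Rightarrow> bool"
  where "solvable_lie s V br \<longleftrightarrow> (\<exists>n. derived_series s V br n = {0})"

text \<open>Linear functionals on \<open>V\<close> are represented by functions vanishing outside \<open>V\<close>, so that each
  functional has exactly one representative and \<^const>\<open>vector_space.dim\<close> counts correctly.\<close>

definition dual_on :: "(complex \<Rightarrow> 'a::ab_group_add \<Rightarrow> 'a) \<Rightarrow> 'a set \<Rightarrow> ('a \<Rightarrow> complex) set"
  where "dual_on s V = {\<alpha>. linear_on s (*) V \<alpha> \<and> (\<forall>x. x \<notin> V \<longrightarrow> \<alpha> x = 0)}"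

definition scale_functional :: "complex \<Rightarrow> ('a \<Rightarrow> complex) \<Rightarrow> 'a \<Rightarrow> complex"
  where "scale_functional c \<alpha> = (\<lambda>x. c * \<alpha> x)"

definition wedge_1_3 ::
  "('a \<Rightarrow> complex) \<Rightarrow> ('a \<Rightarrow> 'a \<Rightarrow> 'a \<Rightarrow> complex) \<Rightarrow> 'a \<Rightarrow> 'a \<Rightarrow> 'a \<Rightarrow> 'a \<Rightarrow> complex"
  where "wedge_1_3 \<alpha> I x y z t = \<alpha> x * I y z t - \<alpha> y * I x z t + \<alpha> z * I x y t - \<alpha> t * I x y z"

definition dup ::
  "(complex \<Rightarrow> 'a::ab_group_add \<Rightarrow> 'a) \<Rightarrow> 'a set \<Rightarrow> ('a \<Rightarrow> 'a \<Rightarrow> 'a) \<Rightarrow> ('a \<Rightarrow> 'a \<Rightarrow> complex) \<Rightarrow> nat"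
  where "dup s V br B = vector_space.dim scale_functional
    {\<alpha> \<in> dual_on s V. \<forall>x\<in>V. \<forall>y\<in>V. \<forall>z\<in>V. \<forall>t\<in>V. wedge_1_3 \<alpha> (\<lambda>x y z. B (br x y) z) x y z t = 0}"

definition singular_quadratic_lie ::
  "(complex \<Rightarrow> 'a::ab_group_add \<Rightarrow> 'a) \<Rightarrow> 'a set \<Rightarrow> ('a \<Rightarrow> 'a \<Rightarrow> 'a) \<Rightarrow> ('a \<Rightarrow> 'a \<Rightarrow> complex) \<Rightarrow> bool"
  where "singular_quadratic_lie s V br B \<longleftrightarrow>
    quadratic_lie_algebra s V br B \<and> (\<exists>x\<in>V. \<exists>y\<in>V. br x y \<noteq> 0) \<and> dup s V br B \<ge> 1"

definition skew_map ::
  "(complex \<Rightarrow> 'a::ab_group_add \<Rightarrow> 'a) \<Rightarrow> 'a set \<Rightarrow> ('a \<Rightarrow> 'a \<Rightarrow> complex) \<Rightarrow> ('a \<Rightarrow> 'a) \<Rightarrow> bool"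
  where "skew_map s q B C \<longleftrightarrow>
    linear_on s s q C \<and> C ` q \<subseteq> q \<and> (\<forall>x\<in>q. \<forall>y\<in>q. B (C x) y = - B x (C y))"

definition plane_sum ::
  "(complex \<Rightarrow> 'a::ab_group_add \<Rightarrow> 'a) \<Rightarrow> 'a \<Rightarrow> 'a \<Rightarrow> 'a set \<Rightarrow> 'a set"
  where "plane_sum s X0 Y0 q = {x + s l X0 + s m Y0 | x l m. x \<in> q}"

text \<open>\<open>(V, br, B)\<close> is, inside the ambient space, the double extension of \<open>(q, B)\<close> by \<open>C\<close>. The
  conditions on \<open>B\<close> force the sum in \<^const>\<open>plane_sum\<close> to be direct and orthogonal, and the bracket
  formula with \<open>x = 0\<close> forces \<open>C = ad Y0\<close> on \<open>q\<close>.\<close>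

definition double_extension ::
  "(complex \<Rightarrow> 'a::ab_group_add \<Rightarrow> 'a) \<Rightarrow> 'a set \<Rightarrow> ('a \<Rightarrow> 'a \<Rightarrow> 'a) \<Rightarrow> ('a \<Rightarrow> 'a \<Rightarrow> complex)
    \<Rightarrow> 'a \<Rightarrow> 'a \<Rightarrow> 'a set \<Rightarrow> ('a \<Rightarrow> 'a) \<Rightarrow> bool"
  where "double_extension s V br B X0 Y0 q C \<longleftrightarrow>
    quadratic_space s q B \<and> skew_map s q B C \<and>
    V = plane_sum s X0 Y0 q \<and> quadratic_space s V B \<and>
    B X0 X0 = 0 \<and> B Y0 Y0 = 0 \<and> B X0 Y0 = 1 \<and> (\<forall>x\<in>q. B X0 x = 0 \<and> B Y0 x = 0) \<and>
    (\<forall>x\<in>q. \<forall>y\<in>q. \<forall>l m l' m'.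
      br (x + s l X0 + s m Y0) (y + s l' X0 + s m' Y0) = s m (C y) - s m' (C x) + s (B (C x) y) X0)"

definition fitting_decomposition ::
  "(complex \<Rightarrow> 'a::ab_group_add \<Rightarrow> 'a) \<Rightarrow> 'a set \<Rightarrow> ('a \<Rightarrow> 'a) \<Rightarrow> 'a set \<Rightarrow> 'a set \<Rightarrow> bool"
  where "fitting_decomposition s q C qN qI \<longleftrightarrow>
    module.subspace s qN \<and> module.subspace s qI \<and>
    q = {x + y | x y. x \<in> qN \<and> y \<in> qI} \<and> qN \<inter> qI = {0} \<and>
    C ` qN \<subseteq> qN \<and> C ` qI \<subseteq> qI \<and>
    (\<exists>k. \<forall>x\<in>qN. (C ^^ k) x = 0) \<and> bij_betw C qI qI"

text \<open>\<open>gN\<close> and \<open>gI\<close>, with the restrictions of \<open>br\<close> and \<open>B\<close>, are the nilpotent and invertible Fitting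
  components of \<open>(V, br, B)\<close> with respect to some realization as a double extension. That they are
  themselves double extensions is \<open>double_extension_nilpotent_part\<close> and
  \<open>double_extension_invertible_part\<close> below.\<close>

definition fitting_components ::
  "(complex \<Rightarrow> 'a::ab_group_add \<Rightarrow> 'a) \<Rightarrow> 'a set \<Rightarrow> ('a \<Rightarrow> 'a \<Rightarrow> 'a) \<Rightarrow> ('a \<Rightarrow> 'a \<Rightarrow> complex)
    \<Rightarrow> 'a set \<Rightarrow> 'a set \<Rightarrow> bool"
  where "fitting_components s V br B gN gI \<longleftrightarrow>
    (\<exists>X0 Y0 q C qN qI. double_extension s V br B X0 Y0 q C \<and> fitting_decomposition s q C qN qI \<and>
      gN = plane_sum s X0 Y0 qN \<and> gI = plane_sum s X0 Y0 qI)"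

definition lie_isomorphism ::
  "(complex \<Rightarrow> 'a::ab_group_add \<Rightarrow> 'a) \<Rightarrow> 'a set \<Rightarrow> ('a \<Rightarrow> 'a \<Rightarrow> 'a)
    \<Rightarrow> (complex \<Rightarrow> 'b::ab_group_add \<Rightarrow> 'b) \<Rightarrow> 'b set \<Rightarrow> ('b \<Rightarrow> 'b \<Rightarrow> 'b) \<Rightarrow> ('a \<Rightarrow> 'b) \<Rightarrow> bool"
  where "lie_isomorphism s V br s' V' br' f \<longleftrightarrow>
    linear_on s s' V f \<and> bij_betw f V V' \<and> (\<forall>x\<in>V. \<forall>y\<in>V. f (br x y) = br' (f x) (f y))"

definition lie_isomorphic ::
  "(complex \<Rightarrow> 'a::ab_group_add \<Rightarrow> 'a) \<Rightarrow> 'a set \<Rightarrow> ('a \<Rightarrow> 'a \<Rightarrow> 'a)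
    \<Rightarrow> (complex \<Rightarrow> 'b::ab_group_add \<Rightarrow> 'b) \<Rightarrow> 'b set \<Rightarrow> ('b \<Rightarrow> 'b \<Rightarrow> 'b) \<Rightarrow> bool"
  where "lie_isomorphic s V br s' V' br' \<longleftrightarrow> (\<exists>f. lie_isomorphism s V br s' V' br' f)"

definition i_isomorphic ::
  "(complex \<Rightarrow> 'a::ab_group_add \<Rightarrow> 'a) \<Rightarrow> 'a set \<Rightarrow> ('a \<Rightarrow> 'a \<Rightarrow> 'a) \<Rightarrow> ('a \<Rightarrow> 'a \<Rightarrow> complex)
    \<Rightarrow> (complex \<Rightarrow> 'b::ab_group_add \<Rightarrow> 'b) \<Rightarrow> 'b set \<Rightarrow> ('b \<Rightarrow> 'b \<Rightarrow> 'b) \<Rightarrow> ('b \<Rightarrow> 'b \<Rightarrow> complex) \<Rightarrow> bool"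
  where "i_isomorphic s V br B s' V' br' B' \<longleftrightarrow>
    (\<exists>f. lie_isomorphism s V br s' V' br' f \<and> (\<forall>x\<in>V. \<forall>y\<in>V. B' (f x) (f y) = B x y))"

lemma vector_space_scale_functional: "vector_space (scale_functional :: complex \<Rightarrow> ('a \<Rightarrow> complex) \<Rightarrow> _)"
  by unfold_locales (auto simp: scale_functional_def fun_eq_iff algebra_simps)

lemma quadratic_space_subspace:
  assumes Q: "quadratic_space s q B" and W: "module.subspace s W" "W \<subseteq> q"
    and nd: "\<And>x. x \<in> W \<Longrightarrow> (\<And>y. y \<in> W \<Longrightarrow> B x y = 0) \<Longrightarrow> x = 0"
  shows "quadratic_space s W B"
proof -
  interpret quadratic_space s q B by fact
  obtain S where S: "finite S" "q = span S" using fin_dim by blast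
  obtain b where b: "b \<subseteq> W" "independent b" "W \<subseteq> span b"
    using maximal_independent_subset[of W] by blast
  have "finite b" using independent_span_bound[of S b] b S W by auto
  moreover have "W = span b" using b W span_minimal by blast
  ultimately have "\<exists>S. finite S \<and> W = span S" by blast
  moreover have "bilinear_on s (*) W B"
    using form_bilinear W(2) unfolding bilinear_on_def linear_on_def by (meson subset_iff)
  ultimately show ?thesis
    using form_sym nd W(2) by unfold_locales auto
qed

lemma skew_funpow:
  assumes "skew_map s q B C" "x \<in> q" "y \<in> q"
  shows "B ((C ^^ k) x) y = (- 1) ^ k * B x ((C ^^ k) y) \<and> (C ^^ k) x \<in> q"
  using assms(2,3)
proof (induction k arbitrary: y)
  case (Suc k)
  have "C y \<in> q" using assms(1) Suc.prems by (auto simp: skew_map_def)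
  then show ?case
    using assms(1) Suc.IH[of "C y"] Suc.IH[of y] Suc.prems
    by (auto simp: skew_map_def funpow_swap1)
qed simp

lemma fitting_decompositionD:
  assumes "fitting_decomposition s q C qN qI"
  shows "module.subspace s qN" "module.subspace s qI"
    "q = {x + y | x y. x \<in> qN \<and> y \<in> qI}" "C ` qN \<subseteq> qN" "C ` qI \<subseteq> qI"
    "\<exists>k. \<forall>x\<in>qN. (C ^^ k) x = 0" "bij_betw C qI qI"
  by (insert assms[unfolded fitting_decomposition_def], (elim conjE, assumption)+)

lemma fitting_subset:
  assumes "vector_space s" "fitting_decomposition s q C qN qI"
  shows "qN \<subseteq> q" "qI \<subseteq> q"
proof -
  interpret vector_space s by fact
  note q = fitting_decompositionD(3)[OF assms(2)]
  have 0: "0 \<in> qN" "0 \<in> qI"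
    using fitting_decompositionD(1,2)[OF assms(2)] by (simp_all add: subspace_0)
  show "qN \<subseteq> q"
  proof
    fix x assume "x \<in> qN"
    then have "x + 0 \<in> q" unfolding q using 0(2) by blast
    then show "x \<in> q" by simp
  qed
  show "qI \<subseteq> q"
  proof
    fix x assume "x \<in> qI"
    then have "0 + x \<in> q" unfolding q using 0(1) by blast
    then show "x \<in> q" by simp
  qed
qed

lemma fitting_orthogonal:
  assumes Q: "quadratic_space s q B" and C: "skew_map s q B C"
    and F: "fitting_decomposition s q C qN qI" and x: "x \<in> qN" and y: "y \<in> qI"
  shows "B x y = 0"
proof -
  interpret quadratic_space s q B by fact
  obtain k where k: "\<And>x. x \<in> qN \<Longrightarrow> (C ^^ k) x = 0"
    using fitting_decompositionD(6)[OF F] by blast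
  note sub = fitting_subset[OF vector_space_axioms F]
  have "bij_betw (C ^^ k) qI qI"
    using fitting_decompositionD(7)[OF F] by (rule bij_betw_funpow)
  then obtain z where z: "z \<in> qI" "y = (C ^^ k) z" using y by (auto simp: bij_betw_def)
  have mem: "x \<in> q" "z \<in> q" "y \<in> q" using x y z sub by auto
  have "linear_on s (*) q (\<lambda>x. B x z)" using form_bilinear mem by (auto simp: bilinear_on_def)
  then have "B (s 0 x) z = 0 * B x z" using mem unfolding linear_on_def by blast
  then have "B 0 z = 0" by simp
  then have "(- 1) ^ k * B x y = 0"
    using skew_funpow[OF C mem(1,2), of k] k[OF x] z by simp
  then show ?thesis by simp
qed

lemma double_extension_part:
  assumes D: "double_extension s V br B X0 Y0 q C"
    and W: "module.subspace s W" "W \<subseteq> q" "C ` W \<subseteq> W" and QW: "quadratic_space s W B"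
  shows "double_extension s (plane_sum s X0 Y0 W) br B X0 Y0 W C"
proof -
  have QV: "quadratic_space s V B" and V: "V = plane_sum s X0 Y0 q" and Qq: "quadratic_space s q B"
    using D by (auto simp: double_extension_def)
  interpret V: quadratic_space s V B by fact
  interpret q: quadratic_space s q B by fact
  interpret W: quadratic_space s W B by fact
  have B0: "B X0 X0 = 0" "B Y0 Y0 = 0" "B X0 Y0 = 1" "\<And>x. x \<in> q \<Longrightarrow> B X0 x = 0"
    "\<And>x. x \<in> q \<Longrightarrow> B Y0 x = 0"
    using D by (auto simp: double_extension_def)
  have sV: "V.subspace V" using V.fin_dim V.subspace_span by metis
  have sq: "V.subspace q" using q.fin_dim V.subspace_span by metis
  have q0: "0 \<in> q" "0 \<in> W" using sq W by (auto simp: V.subspace_def)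
  have inV: "x + s l X0 + s m Y0 \<in> V" if "x \<in> q" for x l m
    using that unfolding V plane_sum_def by blast
  have mem: "X0 \<in> V" "Y0 \<in> V" "\<And>x. x \<in> q \<Longrightarrow> x \<in> V"
    using inV[OF q0(1), of 1 0] inV[OF q0(1), of 0 1] inV[of _ 0 0] by auto
  have addl: "B (x + y) z = B x z + B y z" and scl: "B (s c x) z = c * B x z"
    if "x \<in> V" "y \<in> V" "z \<in> V" for x y z c
    using V.form_bilinear that by (auto simp: bilinear_on_def linear_on_def)
  have B0': "B Y0 X0 = 1" "B x X0 = 0" "B x Y0 = 0" if "x \<in> q" for x
    using that B0 mem V.form_sym by metis+
  have ev: "B (x + s l X0 + s m Y0) z = B x z + l * B X0 z + m * B Y0 z"
    if "x \<in> q" "z \<in> V" for x l m z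
    using that mem sV by (simp add: addl scl V.subspace_def)
  let ?P = "plane_sum s X0 Y0 W"
  have "V.subspace ?P"
  proof (rule V.subspaceI)
    show "0 \<in> ?P" unfolding plane_sum_def using q0
      by (auto intro!: exI[of _ 0] exI[of _ "0::complex"])
  next
    fix u v assume "u \<in> ?P" "v \<in> ?P"
    then obtain x l m x' l' m' where "x \<in> W" "x' \<in> W"
      "u = x + s l X0 + s m Y0" "v = x' + s l' X0 + s m' Y0"
      unfolding plane_sum_def by blast
    then have "u + v = (x + x') + s (l + l') X0 + s (m + m') Y0" "x + x' \<in> W"
      using W by (auto simp: V.scale_left_distrib V.subspace_def algebra_simps)
    then show "u + v \<in> ?P" unfolding plane_sum_def by blast
  next
    fix c u assume "u \<in> ?P"
    then obtain x l m where "x \<in> W" "u = x + s l X0 + s m Y0"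
      unfolding plane_sum_def by blast
    then have "s c u = s c x + s (c * l) X0 + s (c * m) Y0" "s c x \<in> W"
      using W by (auto simp: V.scale_right_distrib V.subspace_def)
    then show "s c u \<in> ?P" unfolding plane_sum_def by blast
  qed
  note sP = this
  have PV: "?P \<subseteq> V" using W(2) unfolding V plane_sum_def by blast
  have "u = 0" if u: "u \<in> ?P" and o: "\<And>v. v \<in> ?P \<Longrightarrow> B u v = 0" for u
  proof -
    obtain x l m where x: "x \<in> W" and ueq: "u = x + s l X0 + s m Y0"
      using u unfolding plane_sum_def by blast
    have P: "y + s l' X0 + s m' Y0 \<in> ?P" if "y \<in> W" for y l' m'
      using that unfolding plane_sum_def by blast
    have "X0 \<in> ?P" "Y0 \<in> ?P" and WP: "\<And>y. y \<in> W \<Longrightarrow> y \<in> ?P"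
      using P[OF q0(2), of 1 0] P[OF q0(2), of 0 1] P[of _ 0 0] by auto
    then have "B u X0 = 0" "B u Y0 = 0" using o by auto
    moreover have xq: "x \<in> q" using x W by auto
    ultimately have lm: "m = 0" "l = 0"
      using ev[OF xq mem(1), of l m] ev[OF xq mem(2), of l m] B0 B0'[OF xq] ueq by auto
    then have "u = x" using ueq by simp
    then show "u = 0" using W.form_nondegenerate[OF x] o WP by auto
  qed
  then have "quadratic_space s ?P B" by (rule quadratic_space_subspace[OF QV sP PV])
  moreover have "skew_map s W B C"
  proof -
    have "skew_map s q B C" using D by (simp add: double_extension_def)
    then show ?thesis using W unfolding skew_map_def linear_on_def by (simp add: subset_iff)
  qed
  moreover have "br (x + s l X0 + s m Y0) (y + s l' X0 + s m' Y0)
      = s m (C y) - s m' (C x) + s (B (C x) y) X0" if "x \<in> W" "y \<in> W" for x y l m l' m'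
  proof -
    have "x \<in> q" "y \<in> q" using that W(2) by auto
    then show ?thesis using D unfolding double_extension_def by blast
  qed
  ultimately show ?thesis
    using QW B0 W(2) unfolding double_extension_def by (simp add: subset_iff)
qed

lemma
  assumes D: "double_extension s V br B X0 Y0 q C" and F: "fitting_decomposition s q C qN qI"
  shows double_extension_nilpotent_part:
      "double_extension s (plane_sum s X0 Y0 qN) br B X0 Y0 qN C" (is ?N)
    and double_extension_invertible_part:
      "double_extension s (plane_sum s X0 Y0 qI) br B X0 Y0 qI C" (is ?I)
proof -
  have Q: "quadratic_space s q B" and C: "skew_map s q B C"
    using D by (auto simp: double_extension_def)
  interpret quadratic_space s q B by fact
  note sub = fitting_subset[OF vector_space_axioms F]
  note sp = fitting_decompositionD(1,2)[OF F] and q = fitting_decompositionD(3)[OF F]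
    and st = fitting_decompositionD(4,5)[OF F]
  have orth: "B x y = 0" "B y x = 0" if "x \<in> qN" "y \<in> qI" for x y
    using fitting_orthogonal[OF Q C F that] form_sym that sub by (auto simp: subset_iff)
  have add: "B z (x + y) = B z x + B z y" if "x \<in> q" "y \<in> q" "z \<in> q" for x y z
    using form_bilinear that by (auto simp: bilinear_on_def linear_on_def)
  have "quadratic_space s qN B"
  proof (rule quadratic_space_subspace[OF Q sp(1) sub(1)])
    fix x assume x: "x \<in> qN" and o: "\<And>y. y \<in> qN \<Longrightarrow> B x y = 0"
    show "x = 0"
    proof (rule form_nondegenerate)
      show "x \<in> q" using x sub by auto
      fix y assume "y \<in> q"
      then obtain a b where "a \<in> qN" "b \<in> qI" "y = a + b" using q by blast
      then show "B x y = 0" using add[of a b x] o orth x sub by (simp add: subset_iff)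
    qed
  qed
  then show ?N using double_extension_part[OF D sp(1) sub(1) st(1)] by blast
  have "quadratic_space s qI B"
  proof (rule quadratic_space_subspace[OF Q sp(2) sub(2)])
    fix x assume x: "x \<in> qI" and o: "\<And>y. y \<in> qI \<Longrightarrow> B x y = 0"
    show "x = 0"
    proof (rule form_nondegenerate)
      show "x \<in> q" using x sub by auto
      fix y assume "y \<in> q"
      then obtain a b where "a \<in> qN" "b \<in> qI" "y = a + b" using q by blast
      then show "B x y = 0" using add[of a b x] o orth x sub by (simp add: subset_iff)
    qed
  qed
  then show ?I using double_extension_part[OF D sp(2) sub(2) st(2)] by blast
qed

end

theory Submission
  imports Defs "HOL-Computational_Algebra.Fundamental_Theorem_Algebra"
begin

text \<open>The theorem is reduced to linear algebra: two double extensions, by \<open>C\<close> on \<open>q\<close> and by \<open>C'\<close> on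
  \<open>q'\<close>, are isomorphic as Lie algebras if and only if \<open>C\<close> is similar to a nonzero multiple of \<open>C'\<close>,
  and they are then even i-isomorphic (\<open>double_extension_isomorphic_iff\<close>). The whole algebras and
  their components \<open>gN\<close> and \<open>gI\<close> are all double extensions, so that the two equivalences of the
  theorem become one and the same statement about the Fitting components of \<open>C\<close> and \<open>C'\<close>.

  From a Lie isomorphism \<open>f\<close> to a similarity: a Lie isomorphism need not match the lines of \<open>X0\<close> and
  \<open>X0'\<close>. But for every \<open>Z\<close> with \<open>m = B Z X0 \<noteq> 0\<close>, the operator \<open>ad Z\<close> is similar to \<open>m\<close> times
  \<open>ad Y0\<close> (\<open>ad_similar\<close>), and a general \<open>Z\<close> satisfies this condition together with its image
  \<open>f Z\<close>. Hence \<open>ad Y0\<close> and \<open>ad Y0'\<close> are similar up to a factor. They are \<open>C\<close> and \<open>C'\<close> extended by zero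
  to a plane, and this plane can be cancelled (\<open>similar_on_cancel_line\<close>).

  From a similarity to an i-isomorphism: a similarity between two skew-symmetric operators is turned
  into an isometric one by a polar decomposition (\<open>isometric_similarity\<close>). The operator comparing the
  two forms has a square root that is a polynomial in it, and this root commutes with \<open>C\<close> and is
  self-adjoint. The isometry extends to the double extensions by rescaling the hyperbolic plane.

  Fitting components: a similarity respects kernels and images of powers, hence the Fitting
  decomposition. In the other direction the similarities on the two components may involve different
  factors, but a nilpotent operator is similar to all its nonzero multiples
  (\<open>similar_on_nilpotent_scale\<close>), so the factor on the nilpotent component can be adapted to that on
  the invertible one (\<open>similar_up_to_scale_fitting_iff\<close>).\<close>

section \<open>Linear maps between finite-dimensional carriers\<close>

lemma linear_onD:
  assumes "linear_on s s' V f"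
  shows "\<And>x y. x \<in> V \<Longrightarrow> y \<in> V \<Longrightarrow> f (x + y) = f x + f y"
    and "\<And>c x. x \<in> V \<Longrightarrow> f (s c x) = s' c (f x)"
  using assms by (auto simp: linear_on_def)

lemma linear_imp_linear_on: "Vector_Spaces.linear s s' f \<Longrightarrow> linear_on s s' V f"
  by (simp add: Vector_Spaces.linear_iff linear_on_def)

lemma linear_on_subset: "linear_on s s' V f \<Longrightarrow> W \<subseteq> V \<Longrightarrow> linear_on s s' W f"
  by (simp add: linear_on_def subset_iff)

lemma linear_on_compose:
  "linear_on s s' V f \<Longrightarrow> linear_on s' s'' W g \<Longrightarrow> f ` V \<subseteq> W \<Longrightarrow> linear_on s s'' V (\<lambda>x. g (f x))"
  by (auto simp: linear_on_def image_subset_iff)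

context fin_dim_space
begin

lemma subspace_carrier: "subspace V"
  using fin_dim subspace_span by metis

lemma carrier_closed:
  "0 \<in> V" "x \<in> V \<Longrightarrow> y \<in> V \<Longrightarrow> x + y \<in> V" "x \<in> V \<Longrightarrow> y \<in> V \<Longrightarrow> x - y \<in> V"
  "x \<in> V \<Longrightarrow> - x \<in> V" "x \<in> V \<Longrightarrow> s c x \<in> V"
  using subspace_carrier
  by (auto simp: subspace_0 subspace_add subspace_diff subspace_neg subspace_scale)

lemma fin_dim_subspace:
  assumes "subspace W" "W \<subseteq> V"
  shows "fin_dim_space s W"
proof -
  obtain S where S: "finite S" "V = span S" using fin_dim by blast
  obtain b where b: "b \<subseteq> W" "independent b" "W \<subseteq> span b"
    using maximal_independent_subset[of W] by blast
  have "finite b" using independent_span_bound[of S b] b S assms by auto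
  moreover have "W = span b" using b assms(1) span_minimal by blast
  ultimately show ?thesis by unfold_locales blast
qed

lemma carrier_basis:
  obtains b where "finite b" "independent b" "V = span b" "b \<subseteq> V"
proof -
  obtain S where S: "finite S" "V = span S" using fin_dim by blast
  obtain b where b: "b \<subseteq> V" "independent b" "V \<subseteq> span b"
    using maximal_independent_subset[of V] by blast
  have "finite b" using independent_span_bound[of S b] b S by auto
  moreover have "V = span b" using b subspace_carrier span_minimal by blast
  ultimately show ?thesis using that b by blast
qed

lemma linear_on_diff_zero:
  assumes "vector_space s'" "linear_on s s' V f"
  shows "f 0 = 0" and "x \<in> V \<Longrightarrow> y \<in> V \<Longrightarrow> f (x - y) = f x - f y"
proof -
  interpret W: vector_space s' by fact
  note f = linear_onD[OF assms(2)]
  show "f 0 = 0" using f(2)[of 0 0] carrier_closed by simp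
  show "f (x - y) = f x - f y" if "x \<in> V" "y \<in> V"
    using f(1)[of "x - y" y] that carrier_closed by (simp add: eq_diff_eq)
qed

lemma inj_on_linear_on_iff:
  assumes "vector_space s'" "linear_on s s' V f"
  shows "inj_on f V \<longleftrightarrow> (\<forall>x\<in>V. f x = 0 \<longrightarrow> x = 0)"
proof
  show "inj_on f V \<Longrightarrow> \<forall>x\<in>V. f x = 0 \<longrightarrow> x = 0"
    using linear_on_diff_zero[OF assms] carrier_closed(1) by (metis inj_onD)
  assume *: "\<forall>x\<in>V. f x = 0 \<longrightarrow> x = 0"
  show "inj_on f V"
  proof (rule inj_onI)
    fix x y assume "x \<in> V" "y \<in> V" "f x = f y"
    then have "f (x - y) = 0" "x - y \<in> V" using linear_on_diff_zero(2)[OF assms] carrier_closed(3) by simp_all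
    then have "x - y = 0" using * by blast
    then show "x = y" by simp
  qed
qed

text \<open>The library's existence results (one-sided inverses, extension from bases) concern maps
  that are linear on a whole type; this lemma makes them available for maps that are only
  constrained on a carrier.\<close>

lemma linear_on_extend:
  assumes "vector_space s'" "linear_on s s' V f"
  obtains g where "Vector_Spaces.linear s s' g" "\<And>x. x \<in> V \<Longrightarrow> g x = f x"
proof -
  interpret W: vector_space s' by fact
  interpret vector_space_pair s s' ..
  obtain b where b: "independent b" "V = span b" "b \<subseteq> V" by (rule carrier_basis)
  obtain g where g: "Vector_Spaces.linear s s' g" "\<forall>x\<in>b. g x = f x"
    using linear_independent_extend[OF b(1)] by blast
  have "x \<in> V \<and> g x = f x" if "x \<in> span b" for x
    using that
  proof (induction rule: span_induct_alt)
    case base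
    then show ?case using linear_on_diff_zero(1)[OF assms] g(1) carrier_closed(1) by (simp add: linear_0)
  next
    case (step c x y)
    then have "x \<in> V" "y \<in> V" using b(3) by auto
    then show ?case
      using step g linear_onD[OF assms(2)] carrier_closed(2,5)
      by (simp add: linear_add linear_scale)
  qed
  then show ?thesis using that g(1) b(2) by blast
qed

lemma inj_endo_surj:
  assumes "linear_on s s V f" "f ` V \<subseteq> V" "inj_on f V"
  shows "f ` V = V"
proof (rule ccontr)
  assume "f ` V \<noteq> V"
  then obtain y where y: "y \<in> V" "y \<notin> f ` V" using assms(2) by blast
  obtain g where g: "Vector_Spaces.linear s s g" "\<And>x. x \<in> V \<Longrightarrow> g x = f x"
    using linear_on_extend[OF vector_space_axioms assms(1)] by blast
  obtain b where b: "finite b" "independent b" "V = span b" "b \<subseteq> V" by (rule carrier_basis)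
  interpret vector_space_pair s s ..
  have im: "g ` V = f ` V" and inj: "inj_on g V"
    using g(2) assms(3) by (auto simp: image_def inj_on_def)
  have "independent (g ` b)"
    using linear_independent_injective_image[OF g(1) b(2)] b(3) inj by simp
  moreover have "y \<notin> span (g ` b)"
    using y linear_span_image[OF g(1)] b(3) im by metis
  ultimately have "independent (insert y (g ` b))" by (rule independent_insertI[rotated])
  moreover have "insert y (g ` b) \<subseteq> span b" using y b im assms(2) by blast
  ultimately have "card (insert y (g ` b)) \<le> card b" using independent_span_bound b(1) by blast
  moreover have "card (g ` b) = card b" using inj b(4) card_image inj_on_subset by metis
  moreover have "y \<notin> g ` b" using y im b(4) by blast
  ultimately show False using b(1) by simp
qed

lemma surj_endo_inj:
  assumes "linear_on s s V f" "f ` V = V"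
  shows "inj_on f V"
proof -
  obtain g where g: "Vector_Spaces.linear s s g" "\<And>x. x \<in> V \<Longrightarrow> g x = f x"
    using linear_on_extend[OF vector_space_axioms assms(1)] by blast
  interpret vector_space_pair s s ..
  have im: "g ` V = V" using g(2) assms(2) by (auto simp: image_def)
  obtain h where h: "range h \<subseteq> V" "Vector_Spaces.linear s s h" "\<forall>v\<in>g ` V. g (h v) = v"
    using linear_exists_right_inverse_on[OF g(1) subspace_carrier] by blast
  have fh: "f (h v) = v" if "v \<in> V" for v using that h g(2) im by (metis range_subsetD)
  have "h ` V = V"
    by (rule inj_endo_surj[OF linear_imp_linear_on[OF h(2)]])
       (use h(1) fh in \<open>auto intro: inj_on_inverseI\<close>)
  then show ?thesis using fh by (metis (no_types, lifting) image_iff inj_onI)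
qed

end

lemma fin_dim_space_linear_image:
  assumes "fin_dim_space s V" "vector_space s'" "linear_on s s' V f"
  shows "fin_dim_space s' (f ` V)"
proof -
  interpret V: fin_dim_space s V by fact
  interpret W: vector_space s' by fact
  interpret vector_space_pair s s' ..
  obtain g where g: "Vector_Spaces.linear s s' g" "\<And>x. x \<in> V \<Longrightarrow> g x = f x"
    using V.linear_on_extend[OF assms(2,3)] by blast
  obtain S where "finite S" "V = V.span S" using V.fin_dim by blast
  then have "f ` V = W.span (g ` S)" "finite (g ` S)"
    using linear_span_image[OF g(1), of S] g(2) by (auto simp: image_def)
  then show ?thesis by unfold_locales blast
qed

lemma linear_on_the_inv_into:
  assumes "fin_dim_space s V" "linear_on s s' V f" "bij_betw f V V'"
  shows "linear_on s' s V' (the_inv_into V f)"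
proof -
  interpret V: fin_dim_space s V by fact
  have inj: "inj_on f V" and im: "V' = f ` V" using assms(3) by (auto simp: bij_betw_def)
  show ?thesis
    unfolding linear_on_def im using linear_onD[OF assms(2), symmetric] V.carrier_closed(2,5) inj
    by (auto simp: the_inv_into_f_f)
qed

section \<open>Similar linear operators\<close>

definition similar_on ::
  "(complex \<Rightarrow> 'a::ab_group_add \<Rightarrow> 'a) \<Rightarrow> 'a set \<Rightarrow> ('a \<Rightarrow> 'a)
    \<Rightarrow> (complex \<Rightarrow> 'b::ab_group_add \<Rightarrow> 'b) \<Rightarrow> 'b set \<Rightarrow> ('b \<Rightarrow> 'b) \<Rightarrow> bool"
  where "similar_on s V T s' V' T' \<longleftrightarrow>
    (\<exists>P. linear_on s s' V P \<and> bij_betw P V V' \<and> (\<forall>x\<in>V. P (T x) = T' (P x)))"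

lemma similar_on_sym:
  assumes "fin_dim_space s V" "T ` V \<subseteq> V" "similar_on s V T s' V' T'"
  shows "similar_on s' V' T' s V T"
proof -
  obtain P where P: "linear_on s s' V P" "bij_betw P V V'" "\<And>x. x \<in> V \<Longrightarrow> P (T x) = T' (P x)"
    using assms(3) by (auto simp: similar_on_def)
  let ?Q = "the_inv_into V P"
  have inj: "inj_on P V" and im: "V' = P ` V" using P(2) by (auto simp: bij_betw_def)
  have "?Q (T' y) = T (?Q y)" if "y \<in> V'" for y
  proof -
    obtain x where x: "x \<in> V" "y = P x" using \<open>y \<in> V'\<close> im by blast
    then have "T x \<in> V" using assms(2) by blast
    then show ?thesis using x inj P(3)[OF x(1), symmetric] by (simp add: the_inv_into_f_f)
  qed
  then show ?thesis
    using linear_on_the_inv_into[OF assms(1) P(1,2)] bij_betw_the_inv_into[OF P(2)]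
    unfolding similar_on_def by blast
qed

lemma similar_on_trans [trans]:
  assumes "similar_on s V T s' V' T'" "similar_on s' V' T' s'' V'' T''"
  shows "similar_on s V T s'' V'' T''"
proof -
  obtain P where P: "linear_on s s' V P" "bij_betw P V V'" "\<And>x. x \<in> V \<Longrightarrow> P (T x) = T' (P x)"
    using assms(1) by (auto simp: similar_on_def)
  obtain Q where Q: "linear_on s' s'' V' Q" "bij_betw Q V' V''" "\<And>x. x \<in> V' \<Longrightarrow> Q (T' x) = T'' (Q x)"
    using assms(2) by (auto simp: similar_on_def)
  have im: "P ` V = V'" using P(2) by (simp add: bij_betw_def)
  have "linear_on s s'' V (\<lambda>x. Q (P x))" using linear_on_compose[OF P(1) Q(1)] im by simp
  moreover have "bij_betw (\<lambda>x. Q (P x)) V V''"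
    using bij_betw_trans[OF P(2) Q(2)] by (simp add: o_def)
  moreover have "Q (P (T x)) = T'' (Q (P x))" if "x \<in> V" for x
    using P(3)[OF that] Q(3)[of "P x"] im that by auto
  ultimately show ?thesis unfolding similar_on_def by blast
qed

lemma similar_on_cong:
  assumes "similar_on s V T s' V' T'" "\<And>x. x \<in> V \<Longrightarrow> T x = U x" "\<And>y. y \<in> V' \<Longrightarrow> T' y = U' y"
  shows "similar_on s V U s' V' U'"
proof -
  obtain P where P: "linear_on s s' V P" "bij_betw P V V'" "\<And>x. x \<in> V \<Longrightarrow> P (T x) = T' (P x)"
    using assms(1) by (auto simp: similar_on_def)
  then have "P (U x) = U' (P x)" if "x \<in> V" for x
    using that assms(2,3) by (metis bij_betwE)
  then show ?thesis using P(1,2) unfolding similar_on_def by blast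
qed

lemma similar_on_scale:
  assumes "similar_on s V T s' V' T'" "T ` V \<subseteq> V"
  shows "similar_on s V (\<lambda>x. s c (T x)) s' V' (\<lambda>x. s' c (T' x))"
proof -
  obtain P where P: "linear_on s s' V P" "bij_betw P V V'" "\<And>x. x \<in> V \<Longrightarrow> P (T x) = T' (P x)"
    using assms(1) by (auto simp: similar_on_def)
  then have "P (s c (T x)) = s' c (T' (P x))" if "x \<in> V" for x
    using linear_onD(2)[OF P(1)] assms(2) that by (metis image_subset_iff)
  then show ?thesis using P(1,2) unfolding similar_on_def by blast
qed

text \<open>A similarity \<open>\<phi>\<close> of the whole spaces need not map the complement \<open>M\<close> of the line of \<open>e\<close> into
  \<open>N\<close>, but one can project \<open>\<phi> ` M\<close> to \<open>N\<close> along \<open>\<phi> e\<close> as soon as \<open>\<phi> e \<notin> N\<close>. If \<open>\<phi> e \<in> N\<close>, then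
  \<open>e\<close> is replaced by \<open>e + w\<close>, where \<open>w\<close> is the component in \<open>M\<close> of the preimage of \<open>e'\<close>; it again
  spans a complement of \<open>M\<close> and is killed by the operator.\<close>

lemma similar_on_cancel_line:
  assumes vs: "vector_space s" "vector_space s'"
    and M: "module.subspace s M" and N: "module.subspace s' N"
    and V: "V = {x + s a e | x a. x \<in> M}" and eM: "e \<notin> M"
    and V': "V' = {y + s' a e' | y a. y \<in> N}" and eN: "e' \<notin> N"
    and T: "linear_on s s V T" "T ` M \<subseteq> M" "T e = 0"
    and T': "linear_on s' s' V' T'" "T' ` N \<subseteq> N" "T' e' = 0"
    and sim: "similar_on s V T s' V' T'"
  shows "similar_on s M T s' N T'"
proof -
  interpret M: vector_space s by fact
  interpret N: vector_space s' by fact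
  note Mc = M.subspace_0[OF M] M.subspace_add[OF M] M.subspace_scale[OF M] M.subspace_diff[OF M]
  note Nc = N.subspace_0[OF N] N.subspace_add[OF N] N.subspace_scale[OF N] N.subspace_diff[OF N]
  have mem: "x + s a e \<in> V" if "x \<in> M" for x a using that V by blast
  have mem': "x + s' a e' \<in> V'" if "x \<in> N" for x a using that V' by blast
  have MV: "x \<in> V" if "x \<in> M" for x using mem[OF that, of 0] by simp
  have NV: "x \<in> V'" if "x \<in> N" for x using mem'[OF that, of 0] by simp
  have eV: "e \<in> V" "e' \<in> V'" using mem[OF Mc(1), of 1] mem'[OF Nc(1), of 1] by auto
  have seV: "s a e \<in> V" "s' a e' \<in> V'" for a
    using mem[OF Mc(1), of a] mem'[OF Nc(1), of a] by auto
  obtain \<phi> where \<phi>: "linear_on s s' V \<phi>" "bij_betw \<phi> V V'"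
    and com: "\<And>x. x \<in> V \<Longrightarrow> \<phi> (T x) = T' (\<phi> x)"
    using sim by (auto simp: similar_on_def)
  note add = linear_onD(1)[OF \<phi>(1)] and sc = linear_onD(2)[OF \<phi>(1)]
  note Tadd = linear_onD(1)[OF T(1)] and Tsc = linear_onD(2)[OF T(1)]
  note Tadd' = linear_onD(1)[OF T'(1)] and Tsc' = linear_onD(2)[OF T'(1)]
  have T'x: "T' (y + s' a e') = T' y" if "y \<in> N" for y a
    using that NV eV seV T'(3) by (simp add: Tadd' Tsc')
  have Tx: "T (x + s a e) = T x" if "x \<in> M" for x a
    using that MV eV seV T(3) by (simp add: Tadd Tsc)
  have uniq: "c = 0" if "y + s' c e' \<in> N" "y \<in> N" for y c
  proof (rule ccontr)
    assume c: "c \<noteq> 0"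
    have "s' c e' \<in> N" using Nc(4)[OF that] by simp
    then have "s' (1 / c) (s' c e') \<in> N" by (rule Nc(3))
    then show False using c eN by simp
  qed
  have inj: "inj_on \<phi> V" and im: "\<phi> ` V = V'" using \<phi>(2) by (auto simp: bij_betw_def)
  \<comment> \<open>a vector of \<open>e + M\<close> killed by \<open>T\<close> and mapped outside \<open>N\<close>\<close>
  obtain w n0 a0 where w: "w \<in> M" "T w = 0" and n0: "n0 \<in> N" "a0 \<noteq> 0" "\<phi> (w + e) = n0 + s' a0 e'"
  proof -
    obtain n1 a1 where 1: "n1 \<in> N" "\<phi> e = n1 + s' a1 e'" using im eV V' by blast
    show ?thesis
    proof (cases "a1 = 0")
      case False
      have "T 0 = 0" using Tsc[OF MV[OF Mc(1)], of 0] by simp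
      then show ?thesis using that[of 0 n1 a1] 1 False Mc(1) by simp
    next
      case True
      obtain v where v: "v \<in> V" "\<phi> v = e'" using im eV by blast
      obtain w c where w: "w \<in> M" "v = w + s c e" using v V by blast
      have "\<phi> (T v) = 0" using com[OF v(1)] v T'(3) by simp
      moreover have "\<phi> 0 = 0" using sc[OF MV[OF Mc(1)], of 0] by simp
      moreover have "T v \<in> V" using Tx w T(2) MV by blast
      ultimately have "T v = 0" using inj MV[OF Mc(1)] by (metis inj_onD)
      then have "T w = 0" using Tx w by simp
      have "w + e = v + s (1 - c) e" using w by (simp add: M.scale_left_diff_distrib)
      then have "\<phi> (w + e) = e' + s' (1 - c) n1"
        using add sc v eV seV 1 True by simp
      then have "\<phi> (w + e) = s' (1 - c) n1 + s' 1 e'" by simp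
      then show ?thesis using that[of w "s' (1 - c) n1" 1] w \<open>T w = 0\<close> 1(1) Nc(3) by simp
    qed
  qed
  define u where "u = w + e"
  have uV: "u \<in> V" "\<And>c. s c u \<in> V" and Tu: "T u = 0"
  proof -
    show "u \<in> V" using mem[OF w(1), of 1] by (simp add: u_def)
    show "s c u \<in> V" for c
      using mem[OF Mc(3)[OF w(1)], of c c] by (simp add: u_def M.scale_right_distrib)
    show "T u = 0" using Tx[OF w(1), of 1] w(2) by (simp add: u_def)
  qed
  have xu: "x + s c u \<in> V" if "x \<in> M" for x c
    using mem[OF Mc(2)[OF that Mc(3)[OF w(1)]], of c c]
    by (simp add: u_def M.scale_right_distrib add.assoc)
  have u_out: "c = 0" if "s c u \<in> M" for c
  proof (rule ccontr)
    assume c: "c \<noteq> 0"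
    have "s (1 / c) (s c u) - w \<in> M" using that w(1) Mc(3,4) by blast
    then show False using c eM by (simp add: u_def)
  qed
  have \<phi>u: "\<phi> (v + s c u) = \<phi> v + s' c (n0 + s' a0 e')" if "v \<in> V" for v c
    using add[OF that uV(2)] sc[OF uV(1)] n0(3)[folded u_def] by simp
  have "\<exists>c. \<phi> (x + s c u) \<in> N" if x: "x \<in> M" for x
  proof -
    obtain n a where n: "n \<in> N" "\<phi> x = n + s' a e'" using im MV[OF x] V' by blast
    have "\<phi> (x + s (- a / a0) u) = (n + s' a e') + s' (- a / a0) (n0 + s' a0 e')"
      unfolding \<phi>u[OF MV[OF x]] n(2) ..
    also have "\<dots> = n + s' (- a / a0) n0"
      using n0(2) by (simp add: N.scale_right_distrib)
    finally show ?thesis using n(1) n0(1) Nc by metis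
  qed
  then obtain \<kappa> where \<kappa>: "\<And>x. x \<in> M \<Longrightarrow> \<phi> (x + s (\<kappa> x) u) \<in> N" by metis
  have \<kappa>_uniq: "c = d" if "x \<in> M" "\<phi> (x + s c u) \<in> N" "\<phi> (x + s d u) \<in> N" for x c d
  proof -
    have "x + s c u = (x + s d u) + s (c - d) u" by (simp add: M.scale_left_diff_distrib)
    then have "\<phi> (x + s c u) = \<phi> (x + s d u) + s' (c - d) (n0 + s' a0 e')"
      using \<phi>u[OF xu[OF that(1)]] by metis
    then have "\<phi> (x + s c u) = (\<phi> (x + s d u) + s' (c - d) n0) + s' ((c - d) * a0) e'"
      by (simp add: N.scale_right_distrib add.assoc)
    then have "(c - d) * a0 = 0"
      using uniq[of "\<phi> (x + s d u) + s' (c - d) n0"] that n0(1) Nc(2,3) by metis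
    then show ?thesis using n0(2) by simp
  qed
  define P where "P = (\<lambda>x. \<phi> (x + s (\<kappa> x) u))"
  have Padd: "P (x + y) = P x + P y" if "x \<in> M" "y \<in> M" for x y
  proof -
    have eq: "(x + y) + s (\<kappa> x + \<kappa> y) u = (x + s (\<kappa> x) u) + (y + s (\<kappa> y) u)"
      by (simp add: M.scale_left_distrib algebra_simps)
    have eq2: "\<phi> ((x + y) + s (\<kappa> x + \<kappa> y) u) = P x + P y"
      unfolding eq P_def using add xu that by blast
    then have "\<phi> ((x + y) + s (\<kappa> x + \<kappa> y) u) \<in> N" using \<kappa> that Nc(2) by (simp add: P_def)
    then have "\<kappa> (x + y) = \<kappa> x + \<kappa> y" using \<kappa>_uniq \<kappa> that Mc(2) by metis
    then show ?thesis using eq2 by (simp add: P_def)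
  qed
  have Psc: "P (s c x) = s' c (P x)" if "x \<in> M" for c x
  proof -
    have eq: "s c x + s (c * \<kappa> x) u = s c (x + s (\<kappa> x) u)"
      by (simp add: M.scale_right_distrib)
    have eq2: "\<phi> (s c x + s (c * \<kappa> x) u) = s' c (P x)"
      unfolding eq P_def using sc xu that by blast
    then have "\<phi> (s c x + s (c * \<kappa> x) u) \<in> N" using \<kappa> that Nc(3) by (simp add: P_def)
    then have "\<kappa> (s c x) = c * \<kappa> x" using \<kappa>_uniq \<kappa> that Mc(3) by metis
    then show ?thesis using eq2 by (simp add: P_def)
  qed
  have "linear_on s s' M P" using Padd Psc by (simp add: linear_on_def)
  moreover have "bij_betw P M N"
  proof (rule bij_betw_imageI)
    show "inj_on P M"
    proof (rule inj_onI)
      fix x y assume xy: "x \<in> M" "y \<in> M" "P x = P y"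
      then have "x + s (\<kappa> x) u = y + s (\<kappa> y) u"
        using inj xu unfolding P_def by (blast dest: inj_onD)
      then have "s (\<kappa> y - \<kappa> x) u = x - y"
        by (simp add: M.scale_left_diff_distrib algebra_simps)
      then have "\<kappa> y - \<kappa> x = 0" using u_out Mc(4) xy by metis
      then show "x = y" using \<open>s (\<kappa> y - \<kappa> x) u = x - y\<close> by simp
    qed
    show "P ` M = N"
    proof
      show "P ` M \<subseteq> N" using \<kappa> by (auto simp: P_def)
      show "N \<subseteq> P ` M"
      proof
        fix n assume n: "n \<in> N"
        then obtain v where v: "v \<in> V" "\<phi> v = n" using im NV by blast
        then obtain x c where x: "x \<in> M" "v = x + s c e" using V by blast
        have x': "x - s c w \<in> M" using x(1) w(1) Mc(3,4) by blast
        have veq: "v = (x - s c w) + s c u" using x by (simp add: u_def M.scale_right_distrib)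
        then have "\<kappa> (x - s c w) = c" using \<kappa>_uniq[OF x'] \<kappa>[OF x'] v n by metis
        then have "P (x - s c w) = n" using v veq by (simp add: P_def)
        then show "n \<in> P ` M" using x' by blast
      qed
    qed
  qed
  moreover have "P (T x) = T' (P x)" if x: "x \<in> M" for x
  proof -
    have "T (x + s (\<kappa> x) u) = T x"
      using Tadd[OF MV[OF x] uV(2)] Tsc[OF uV(1)] Tu by simp
    then have eq: "\<phi> (T x) = T' (P x)" using com[OF xu[OF x]] unfolding P_def by metis
    moreover have "T' (P x) \<in> N" using T'(2) \<kappa>[OF x] by (auto simp: P_def)
    ultimately have "\<phi> (T x + s 0 u) \<in> N" by simp
    moreover have Tx: "T x \<in> M" using T(2) x by blast
    ultimately have "\<kappa> (T x) = 0" using \<kappa>_uniq[OF Tx] \<kappa>[OF Tx] by blast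
    then show ?thesis using eq by (simp add: P_def)
  qed
  ultimately show ?thesis unfolding similar_on_def by blast
qed

section \<open>Rescaling a nilpotent operator\<close>

lemma funpow_cong_on:
  assumes "\<And>x. x \<in> V \<Longrightarrow> f x = g x" "f ` V \<subseteq> V" "x \<in> V"
  shows "(f ^^ k) x = (g ^^ k) x \<and> (f ^^ k) x \<in> V"
proof (induction k)
  case (Suc k)
  then show ?case using assms(1)[of "(f ^^ k) x"] assms(2) by auto
qed (use assms in simp)

lemma linear_on_funpow:
  assumes "linear_on s s V f" "f ` V \<subseteq> V"
  shows "linear_on s s V (f ^^ k)" "(f ^^ k) ` V \<subseteq> V"
proof -
  have "linear_on s s V (f ^^ k) \<and> (f ^^ k) ` V \<subseteq> V"
  proof (induction k)
    case (Suc k)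
    then show ?case using linear_on_compose[of s s V "f ^^ k" s V f] assms by (auto simp: o_def)
  qed (auto simp: linear_on_def)
  then show "linear_on s s V (f ^^ k)" "(f ^^ k) ` V \<subseteq> V" by auto
qed

text \<open>The reason is visible on a Jordan block, where a diagonal matrix of powers of \<open>t\<close> conjugates the
  operator to its multiple. Without a Jordan basis, one argues by induction on the nilpotency index:
  there is a similarity \<open>Q\<close> on the image \<open>Z = T ` W\<close>. On a vector outside the image
  the value of \<open>P\<close> is prescribed by \<open>T (P w) = Q (T w) / t\<close> up to \<open>ker T\<close>, so it can be lifted; the
  only choice left is on a complement \<open>K\<close> of \<open>ker T \<inter> Z\<close> in \<open>ker T\<close>, where the identity makes \<open>P\<close>
  surjective.\<close>

lemma similar_on_nilpotent_scale_aux: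
  assumes "fin_dim_space s W" "Vector_Spaces.linear s s T" "T ` W \<subseteq> W"
    and "\<And>x. x \<in> W \<Longrightarrow> (T ^^ k) x = 0" and t: "t \<noteq> 0"
  shows "similar_on s W T s W (\<lambda>x. s t (T x))"
  using assms(1,3,4)
proof (induction k arbitrary: W)
  case 0
  interpret W: fin_dim_space s W by fact
  interpret T: Vector_Spaces.linear s s T by fact
  have "W = {0}" using 0(3) W.carrier_closed(1) by auto
  then show ?case
    unfolding similar_on_def by (intro exI[of _ id]) (auto simp: linear_on_def)
next
  case (Suc k)
  interpret W: fin_dim_space s W by fact
  interpret pr: vector_space_pair s s ..
  note T = assms(2)
  define Z where "Z = T ` W"
  have ZW: "Z \<subseteq> W" using Suc.prems(2) by (simp add: Z_def)
  have fZ: "fin_dim_space s Z"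
    unfolding Z_def
    using fin_dim_space_linear_image[OF Suc.prems(1) W.vector_space_axioms linear_imp_linear_on[OF T]] .
  interpret Z: fin_dim_space s Z by fact
  have "similar_on s Z T s Z (\<lambda>x. s t (T x))"
  proof (rule Suc.IH[OF fZ])
    show "T ` Z \<subseteq> Z" using ZW by (auto simp: Z_def)
    show "(T ^^ k) x = 0" if "x \<in> Z" for x
      using that Suc.prems(3) by (auto simp: Z_def funpow_Suc_right simp del: funpow.simps)
  qed
  then obtain Q0 where Q0: "linear_on s s Z Q0" "bij_betw Q0 Z Z" "\<And>x. x \<in> Z \<Longrightarrow> Q0 (T x) = s t (T (Q0 x))"
    by (auto simp: similar_on_def)
  obtain Q where Q: "Vector_Spaces.linear s s Q" and QQ0: "\<And>x. x \<in> Z \<Longrightarrow> Q x = Q0 x"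
    using Z.linear_on_extend[OF W.vector_space_axioms Q0(1)] by blast
  have TZ: "T x \<in> Z" if "x \<in> W" for x using that by (simp add: Z_def)
  have QZ: "Q ` Z = Z" using Q0(2) QQ0 by (simp add: bij_betw_def)
  have QT: "Q (T x) = s t (T (Q x))" if "x \<in> Z" for x
    using Q0(3)[OF that] QQ0 that TZ ZW by auto
  have id: "Vector_Spaces.linear s s (\<lambda>x. x)" by (simp add: Vector_Spaces.linear_iff W.vector_space_axioms)
  have proj: "\<exists>p. range p \<subseteq> U \<and> Vector_Spaces.linear s s p \<and> (\<forall>v\<in>U. p v = v)" if "W.subspace U" for U
    using pr.linear_exists_left_inverse_on[OF id that] by auto
  note lin = pr.linear_add pr.linear_diff pr.linear_0 pr.linear_scale
  have ker: "W.subspace {x \<in> Z. T x = 0}"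
    unfolding W.subspace_def using Z.carrier_closed by (auto simp: lin[OF T])
  obtain \<rho> where \<rho>: "range \<rho> \<subseteq> {x \<in> Z. T x = 0}" "Vector_Spaces.linear s s \<rho>"
      "\<And>v. v \<in> Z \<Longrightarrow> T v = 0 \<Longrightarrow> \<rho> v = v"
    using proj[OF ker] by auto
  define K where "K = {x \<in> W. T x = 0 \<and> \<rho> x = 0}"
  have "W.subspace K"
    unfolding W.subspace_def K_def using W.carrier_closed by (auto simp: lin[OF T] lin[OF \<rho>(2)])
  then obtain r where r: "range r \<subseteq> K" "Vector_Spaces.linear s s r" "\<And>v. v \<in> K \<Longrightarrow> r v = v"
    using proj by meson
  have rlin: "Vector_Spaces.linear s s (\<lambda>x. x - r x)"
    using pr.linear_compose_sub[OF id r(2)] by simp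
  have "inj_on (\<lambda>x. x - r x) Z"
  proof (subst Z.inj_on_linear_on_iff[OF W.vector_space_axioms linear_imp_linear_on[OF rlin]], intro ballI impI)
    fix x assume x: "x \<in> Z" "x - r x = 0"
    then have "x \<in> K" using r(1) by (metis eq_iff_diff_eq_0 rangeI subsetD)
    then show "x = 0" using \<rho>(3)[OF x(1)] by (simp add: K_def)
  qed
  then obtain g where g: "range g \<subseteq> Z" "Vector_Spaces.linear s s g" "\<And>v. v \<in> Z \<Longrightarrow> g (v - r v) = v"
    using pr.linear_exists_left_inverse_on[OF rlin Z.subspace_carrier] by auto
  \<comment> \<open>projection onto \<open>Z\<close> that vanishes on \<open>K\<close>\<close>
  define p where "p = (\<lambda>x. g (x - r x))"
  have p: "Vector_Spaces.linear s s p" "\<And>x. p x \<in> Z" "\<And>x. x \<in> Z \<Longrightarrow> p x = x" "\<And>x. x \<in> K \<Longrightarrow> p x = 0"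
    using Vector_Spaces.linear_compose[OF rlin g(2)] g r(3) pr.linear_0[OF g(2)] by (auto simp: p_def o_def)
  obtain \<sigma> where \<sigma>: "range \<sigma> \<subseteq> W" "Vector_Spaces.linear s s \<sigma>" "\<And>v. v \<in> Z \<Longrightarrow> T (\<sigma> v) = v"
    using pr.linear_exists_right_inverse_on[OF T W.subspace_carrier] by (auto simp: Z_def)
  define P where "P = (\<lambda>w. Q (p w) + s (1 / t) (\<sigma> (Q (T (w - p w)))) + r (w - p w))"
  have Plin: "Vector_Spaces.linear s s P"
    unfolding Vector_Spaces.linear_iff P_def using W.vector_space_axioms
    by (simp add: lin[OF Q] lin[OF p(1)] lin[OF \<sigma>(2)] lin[OF T] lin[OF r(2)] W.scale_right_distrib
        W.scale_right_diff_distrib mult.commute)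
  have PZ: "P x = Q x" if "x \<in> Z" for x
    using p(3)[OF that] by (simp add: P_def lin[OF Q] lin[OF \<sigma>(2)] lin[OF T] lin[OF r(2)])
  have PK: "P x = x" if "x \<in> K" for x
    using p(4)[OF that] r(3)[OF that] that
    by (simp add: P_def lin[OF Q] lin[OF \<sigma>(2)] K_def)
  have PW: "P x \<in> W" if "x \<in> W" for x
  proof -
    have "Q (p x) \<in> W" using p(2) QZ ZW by blast
    moreover have "r (x - p x) \<in> W" using r(1) by (auto simp: K_def)
    ultimately show ?thesis using \<sigma>(1) W.carrier_closed(2,5) by (simp add: P_def range_subsetD)
  qed
  have TP: "T (P x) = s (1 / t) (Q (T x))" if "x \<in> W" for x
  proof -
    have "x - p x \<in> W" using that p(2) ZW W.carrier_closed(3) by blast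
    then have "Q (T (x - p x)) \<in> Z" using TZ QZ by blast
    moreover have "T (r (x - p x)) = 0" using r(1) by (auto simp: K_def)
    moreover have "T (Q (p x)) = s (1 / t) (Q (T (p x)))" using QT[OF p(2)] t by simp
    ultimately have "T (P x) = s (1 / t) (Q (T (p x))) + s (1 / t) (Q (T (x - p x)))"
      using \<sigma>(3) by (simp add: P_def lin[OF T])
    also have "\<dots> = s (1 / t) (Q (T x))"
      by (simp add: lin[OF T] lin[OF Q] W.scale_right_diff_distrib)
    finally show ?thesis .
  qed
  have "w \<in> P ` W" if w: "w \<in> W" for w
  proof -
    have "s t (T w) \<in> Z" using TZ[OF w] by (rule Z.carrier_closed(5))
    then obtain z0 where "z0 \<in> Z" "Q z0 = s t (T w)" using QZ by (metis imageE)
    then obtain y where y: "y \<in> W" "Q (T y) = s t (T w)" by (auto simp: Z_def)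
    define v where "v = w - P y"
    have v: "v \<in> W" "T v = 0"
      using w y PW W.carrier_closed(3) TP[OF y(1)] t by (auto simp: v_def lin[OF T])
    have "\<rho> v \<in> Z" "T (\<rho> v) = 0" using \<rho>(1) by blast+
    then obtain z where z: "z \<in> Z" "P z = \<rho> v" using QZ PZ by (metis image_iff)
    have "v - \<rho> v \<in> K"
      using v \<open>\<rho> v \<in> Z\<close> \<open>T (\<rho> v) = 0\<close> ZW W.carrier_closed(3) \<rho>(3)
      by (auto simp: K_def lin[OF T] lin[OF \<rho>(2)])
    then have "P (v - \<rho> v) = v - \<rho> v" "v - \<rho> v \<in> W" using PK by (auto simp: K_def)
    then have "P (y + z + (v - \<rho> v)) = w" "y + z + (v - \<rho> v) \<in> W"
      using y z ZW W.carrier_closed(2) by (auto simp: lin(1)[OF Plin] v_def)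
    then show ?thesis by (metis imageI)
  qed
  then have im: "P ` W = W" using PW by blast
  have "bij_betw P W W"
    using W.surj_endo_inj[OF linear_imp_linear_on[OF Plin] im] im by (simp add: bij_betw_def)
  moreover have "P (T x) = s t (T (P x))" if "x \<in> W" for x
    using TP[OF that] PZ[OF TZ[OF that]] t by simp
  ultimately show ?case using linear_imp_linear_on[OF Plin] unfolding similar_on_def by blast
qed

lemma similar_on_nilpotent_scale:
  assumes W: "fin_dim_space s W" and T: "linear_on s s W T" "T ` W \<subseteq> W"
    and nil: "\<And>x. x \<in> W \<Longrightarrow> (T ^^ k) x = 0" and t: "t \<noteq> 0"
  shows "similar_on s W T s W (\<lambda>x. s t (T x))"
proof -
  interpret W: fin_dim_space s W by fact
  obtain g where g: "Vector_Spaces.linear s s g" "\<And>x. x \<in> W \<Longrightarrow> g x = T x"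
    using W.linear_on_extend[OF W.vector_space_axioms T(1)] by blast
  have gW: "g ` W \<subseteq> W" using T(2) g(2) by auto
  have "(g ^^ k) x = 0" if "x \<in> W" for x
    using funpow_cong_on[of W g T, OF g(2) gW that] nil[OF that] by simp
  then have "similar_on s W g s W (\<lambda>x. s t (g x))"
    by (rule similar_on_nilpotent_scale_aux[OF W g(1) gW _ t])
  then show ?thesis by (rule similar_on_cong) (simp_all add: g(2))
qed

section \<open>Fitting decompositions and similarity\<close>

lemma funpow_scale:
  assumes "linear_on s s q C" "C ` q \<subseteq> q" "vector_space s" "x \<in> q"
  shows "((\<lambda>x. s t (C x)) ^^ k) x = s (t ^ k) ((C ^^ k) x)"
proof (induction k)
  case 0
  interpret vector_space s by fact
  show ?case by simp
next
  case (Suc k)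
  interpret vector_space s by fact
  have "(C ^^ k) x \<in> q" using linear_on_funpow(2)[OF assms(1,2), of k] assms(4) by blast
  then show ?case using Suc linear_onD(2)[OF assms(1)] by simp
qed

lemma fitting_decomposition_scale:
  assumes q: "fin_dim_space s q" and C: "linear_on s s q C" "C ` q \<subseteq> q"
    and F: "fitting_decomposition s q C qN qI" and t: "t \<noteq> 0"
  shows "fitting_decomposition s q (\<lambda>x. s t (C x)) qN qI"
proof -
  interpret q: fin_dim_space s q by fact
  note sub = fitting_subset[OF q.vector_space_axioms F]
  note sp = fitting_decompositionD(1,2)[OF F]
  note N = q.subspace_scale[OF sp(1)] and I = q.subspace_scale[OF sp(2)]
  obtain k where k: "\<And>x. x \<in> qN \<Longrightarrow> (C ^^ k) x = 0" using fitting_decompositionD(6)[OF F] by blast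
  have bij: "bij_betw C qI qI" using fitting_decompositionD(7)[OF F] .
  have "bij_betw (\<lambda>x. s t (C x)) qI qI"
  proof (rule bij_betw_imageI)
    show "inj_on (\<lambda>x. s t (C x)) qI" using bij t by (auto simp: bij_betw_def inj_on_def)
    have "y \<in> (\<lambda>x. s t (C x)) ` qI" if y: "y \<in> qI" for y
    proof -
      obtain x where "x \<in> qI" "C x = s (1 / t) y" using I[OF y, of "1 / t"] bij unfolding bij_betw_def by (metis imageE)
      then have "s t (C x) = y" using t by simp
      then show ?thesis using \<open>x \<in> qI\<close> by blast
    qed
    then show "(\<lambda>x. s t (C x)) ` qI = qI"
      using I fitting_decompositionD(5)[OF F] by blast
  qed
  moreover have "\<exists>k. \<forall>x\<in>qN. ((\<lambda>x. s t (C x)) ^^ k) x = 0"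
  proof (intro exI[of _ k] ballI)
    show "((\<lambda>x. s t (C x)) ^^ k) x = 0" if "x \<in> qN" for x
      using funpow_scale[OF C q.vector_space_axioms] that sub k by (simp add: subset_iff)
  qed
  moreover have "(\<lambda>x. s t (C x)) ` qN \<subseteq> qN" "(\<lambda>x. s t (C x)) ` qI \<subseteq> qI"
    using N I fitting_decompositionD(4,5)[OF F] by (simp_all add: image_subset_iff)
  ultimately show ?thesis
    using F[unfolded fitting_decomposition_def]
    unfolding fitting_decomposition_def by (elim conjE) (intro conjI, assumption+)
qed

text \<open>On the nilpotent component a high power vanishes and on the invertible one it is bijective. In
  this description the components depend on the operator alone, so every similarity respects
  them.\<close>

lemma fitting_as_kernel_and_image:
  assumes q: "fin_dim_space s q" and C: "linear_on s s q C" "C ` q \<subseteq> q"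
    and F: "fitting_decomposition s q C qN qI"
  obtains k0 where "\<And>k. k \<ge> k0 \<Longrightarrow> qN = {x \<in> q. (C ^^ k) x = 0} \<and> qI = (C ^^ k) ` q"
proof -
  interpret q: fin_dim_space s q by fact
  note sub = fitting_subset[OF q.vector_space_axioms F]
  note dec = fitting_decompositionD(3)[OF F]
  note sp = fitting_decompositionD(1,2)[OF F]
  obtain k0 where k0: "\<And>x. x \<in> qN \<Longrightarrow> (C ^^ k0) x = 0" using fitting_decompositionD(6)[OF F] by blast
  have "qN = {x \<in> q. (C ^^ k) x = 0} \<and> qI = (C ^^ k) ` q" if "k \<ge> k0" for k
  proof -
    note Ck = linear_on_funpow[OF C, of k]
    note C0 = q.linear_on_diff_zero(1)[OF q.vector_space_axioms]
    have nil: "(C ^^ k) x = 0" if x: "x \<in> qN" for x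
    proof -
      have "(C ^^ k) x = (C ^^ (k - k0)) ((C ^^ k0) x)"
        using \<open>k \<ge> k0\<close> by (metis comp_apply funpow_add le_add_diff_inverse2)
      then show ?thesis using k0[OF x] C0[OF linear_on_funpow(1)[OF C]] by simp
    qed
    have bij: "bij_betw (C ^^ k) qI qI" using fitting_decompositionD(7)[OF F] by (rule bij_betw_funpow)
    have val: "(C ^^ k) (a + b) = (C ^^ k) b" if "a \<in> qN" "b \<in> qI" for a b
      using linear_onD(1)[OF Ck(1)] that sub nil by (simp add: subset_iff)
    have "x \<in> qN" if x: "x \<in> q" "(C ^^ k) x = 0" for x
    proof -
      obtain a b where ab: "a \<in> qN" "b \<in> qI" "x = a + b" using x(1) dec by blast
      then have "(C ^^ k) b = (C ^^ k) 0" using val x(2) C0[OF Ck(1)] by simp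
      then have "b = 0" using bij ab(2) q.subspace_0[OF sp(2)] by (meson bij_betw_def inj_onD)
      then show ?thesis using ab by simp
    qed
    moreover have "(C ^^ k) ` q \<subseteq> qI" using val bij dec by (auto simp: bij_betw_def)
    moreover have "qI \<subseteq> (C ^^ k) ` q" using bij sub(2) by (metis bij_betw_def image_mono)
    ultimately show ?thesis using nil sub by blast
  qed
  then show ?thesis using that by blast
qed

lemma similar_on_fitting:
  assumes q: "fin_dim_space s q" "linear_on s s q C" "C ` q \<subseteq> q" "fitting_decomposition s q C qN qI"
    and q': "fin_dim_space s' q'" "linear_on s' s' q' C'" "C' ` q' \<subseteq> q'"
      "fitting_decomposition s' q' C' qN' qI'"
    and sim: "similar_on s q C s' q' C'"
  shows "similar_on s qN C s' qN' C'" "similar_on s qI C s' qI' C'"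
proof -
  interpret q: fin_dim_space s q by fact
  interpret q': fin_dim_space s' q' by fact
  note sub = fitting_subset[OF q.vector_space_axioms q(4)]
  obtain P where P: "linear_on s s' q P" "bij_betw P q q'" "\<And>x. x \<in> q \<Longrightarrow> P (C x) = C' (P x)"
    using sim by (auto simp: similar_on_def)
  have im: "P ` q = q'" and inj: "inj_on P q" using P(2) by (auto simp: bij_betw_def)
  obtain k0 where k0: "\<And>k. k \<ge> k0 \<Longrightarrow> qN = {x \<in> q. (C ^^ k) x = 0} \<and> qI = (C ^^ k) ` q"
    using fitting_as_kernel_and_image[OF q] by blast
  obtain k1 where k1: "\<And>k. k \<ge> k1 \<Longrightarrow> qN' = {x \<in> q'. (C' ^^ k) x = 0} \<and> qI' = (C' ^^ k) ` q'"
    using fitting_as_kernel_and_image[OF q'] by blast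
  define k where "k = max k0 k1"
  have k: "qN = {x \<in> q. (C ^^ k) x = 0}" "qI = (C ^^ k) ` q"
    "qN' = {x \<in> q'. (C' ^^ k) x = 0}" "qI' = (C' ^^ k) ` q'"
    using k0[of k] k1[of k] by (auto simp: k_def)
  have Ckq: "(C ^^ n) x \<in> q" if "x \<in> q" for x n
    using linear_on_funpow(2)[OF q(2,3), of n] that by blast
  have pow: "P ((C ^^ n) x) = (C' ^^ n) (P x)" if "x \<in> q" for x n
    using Ckq[OF that] P(3) by (induction n) auto
  have P0: "P x = 0 \<longleftrightarrow> x = 0" if "x \<in> q" for x
  proof -
    have "P 0 = 0" by (rule q.linear_on_diff_zero(1)[OF q'.vector_space_axioms P(1)])
    then show ?thesis using inj_onD[OF inj, of x 0] that q.carrier_closed(1) by auto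
  qed
  have "P ` qN = qN'"
  proof -
    have "(C' ^^ k) (P x) = 0 \<longleftrightarrow> (C ^^ k) x = 0" if "x \<in> q" for x
      using pow[OF that] P0[OF Ckq[OF that]] by metis
    then show ?thesis unfolding k im[symmetric] by blast
  qed
  moreover have "P ` qI = qI'"
    unfolding k im[symmetric] image_image by (rule image_cong[OF refl pow])
  ultimately have "bij_betw P qN qN'" "bij_betw P qI qI'"
    using inj sub by (auto simp: bij_betw_def intro: inj_on_subset)
  moreover have "linear_on s s' qN P" "linear_on s s' qI P"
    using linear_on_subset[OF P(1)] sub by auto
  ultimately show "similar_on s qN C s' qN' C'" "similar_on s qI C s' qI' C'"
    using P(3) sub unfolding similar_on_def by blast+
qed

lemma similar_on_direct_sum:
  assumes q: "fin_dim_space s q" "linear_on s s q C" "fitting_decomposition s q C qN qI"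
    and q': "fin_dim_space s' q'" "linear_on s' s' q' C'" "fitting_decomposition s' q' C' qN' qI'"
    and N: "similar_on s qN C s' qN' C'" and I: "similar_on s qI C s' qI' C'"
  shows "similar_on s q C s' q' C'"
proof -
  interpret q: fin_dim_space s q by fact
  interpret q': fin_dim_space s' q' by fact
  note sub = fitting_subset[OF q.vector_space_axioms q(3)]
    and sub' = fitting_subset[OF q'.vector_space_axioms q'(3)]
  note dec = fitting_decompositionD(3)[OF q(3)] and dec' = fitting_decompositionD(3)[OF q'(3)]
  note sp = fitting_decompositionD(1,2)[OF q(3)] and sp' = fitting_decompositionD(1,2)[OF q'(3)]
  have st: "C ` qN \<subseteq> qN" "C ` qI \<subseteq> qI" using fitting_decompositionD(4,5)[OF q(3)] .
  have triv: "qN \<inter> qI = {0}" "qN' \<inter> qI' = {0}"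
    using q(3) q'(3) by (auto simp: fitting_decomposition_def)
  obtain P where P: "linear_on s s' qN P" "bij_betw P qN qN'" "\<And>x. x \<in> qN \<Longrightarrow> P (C x) = C' (P x)"
    using N by (auto simp: similar_on_def)
  obtain R where R: "linear_on s s' qI R" "bij_betw R qI qI'" "\<And>x. x \<in> qI \<Longrightarrow> R (C x) = C' (R x)"
    using I by (auto simp: similar_on_def)
  have imP: "P ` qN = qN'" and imR: "R ` qI = qI'" using P(2) R(2) by (auto simp: bij_betw_def)
  have uniq: "a = a'" "b = b'" if "a \<in> qN" "a' \<in> qN" "b \<in> qI" "b' \<in> qI" "a + b = a' + b'" for a a' b b'
  proof -
    have "a - a' = b' - b" using that(5) by (simp add: algebra_simps)
    then have "a - a' \<in> qN \<inter> qI" using that q.subspace_diff[OF sp(1)] q.subspace_diff[OF sp(2)] by (metis IntI)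
    then show "a = a'" "b = b'" using triv(1) that(5) by auto
  qed
  have "\<forall>x\<in>q. \<exists>a b. a \<in> qN \<and> b \<in> qI \<and> x = a + b" using dec by blast
  then obtain a b where ab: "\<And>x. x \<in> q \<Longrightarrow> a x \<in> qN" "\<And>x. x \<in> q \<Longrightarrow> b x \<in> qI"
    and ab_sum: "\<And>x. x \<in> q \<Longrightarrow> x = a x + b x" by metis
  have ab_eq: "a (u + v) = u \<and> b (u + v) = v" if "u \<in> qN" "v \<in> qI" for u v
  proof -
    have "u + v \<in> q" using that sub q.carrier_closed(2) by blast
    then show ?thesis
      using uniq[OF that(1) ab(1) that(2) ab(2) ab_sum] by simp
  qed
  define f where "f = (\<lambda>x. P (a x) + R (b x))"
  have f: "f (u + v) = P u + R v" if "u \<in> qN" "v \<in> qI" for u v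
    using ab_eq[OF that] by (simp add: f_def)
  note cN = q.subspace_add[OF sp(1)] q.subspace_scale[OF sp(1)]
    and cI = q.subspace_add[OF sp(2)] q.subspace_scale[OF sp(2)]
  have "f (x + y) = f x + f y" if "x \<in> q" "y \<in> q" for x y
  proof -
    have "x + y = (a x + a y) + (b x + b y)" using ab_sum[OF that(1)] ab_sum[OF that(2)] by (simp add: algebra_simps)
    then have "f (x + y) = P (a x + a y) + R (b x + b y)"
      using f[of "a x + a y" "b x + b y"] cN(1) cI(1) ab that by simp
    then show ?thesis
      using linear_onD(1)[OF P(1)] linear_onD(1)[OF R(1)] ab that by (simp add: f_def algebra_simps)
  qed
  moreover have "f (s c x) = s' c (f x)" if "x \<in> q" for c x
  proof -
    have "s c x = s c (a x) + s c (b x)" using ab_sum[OF that] q.scale_right_distrib by metis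
    then have "f (s c x) = P (s c (a x)) + R (s c (b x))"
      using f[of "s c (a x)" "s c (b x)"] cN(2) cI(2) ab that by simp
    then show ?thesis
      using linear_onD(2)[OF P(1)] linear_onD(2)[OF R(1)] ab that by (simp add: f_def q'.scale_right_distrib)
  qed
  ultimately have flin: "linear_on s s' q f" by (simp add: linear_on_def)
  have Pm: "P (a x) \<in> qN'" "R (b x) \<in> qI'" if "x \<in> q" for x using ab that imP imR by auto
  have "bij_betw f q q'"
  proof (rule bij_betw_imageI)
    show "inj_on f q"
    proof (subst q.inj_on_linear_on_iff[OF q'.vector_space_axioms flin], intro ballI impI)
      fix x assume x: "x \<in> q" "f x = 0"
      have "P (a x) = - R (b x)" using x(2) by (simp add: f_def add_eq_0_iff2)
      then have "P (a x) \<in> qN' \<inter> qI'" using Pm[OF x(1)] q'.subspace_neg[OF sp'(2)] by auto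
      then have 0: "P (a x) = 0" "R (b x) = 0" using triv(2) x(2) by (auto simp: f_def)
      have "P 0 = 0" "R 0 = 0"
        using linear_onD(2)[OF P(1), of 0 0] linear_onD(2)[OF R(1), of 0 0] q.subspace_0 sp by auto
      then have "a x = 0" "b x = 0"
        using 0 P(2) R(2) ab(1,2)[OF x(1)] q.subspace_0 sp by (metis bij_betw_def inj_onD)+
      then show "x = 0" using ab_sum[OF x(1)] by simp
    qed
    show "f ` q = q'"
    proof
      show "f ` q \<subseteq> q'" using Pm sub' q'.carrier_closed(2) unfolding f_def by blast
      show "q' \<subseteq> f ` q"
      proof
        fix y assume "y \<in> q'"
        then obtain c d where "c \<in> qN'" "d \<in> qI'" "y = c + d" using dec' by blast
        then obtain u v where "u \<in> qN" "v \<in> qI" "y = P u + R v" using imP imR by blast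
        then have "f (u + v) = y" "u + v \<in> q" using f sub q.carrier_closed(2)[of u v] by auto
        then show "y \<in> f ` q" by blast
      qed
    qed
  qed
  moreover have "f (C x) = C' (f x)" if x: "x \<in> q" for x
  proof -
    have "C x = C (a x) + C (b x)"
      using linear_onD(1)[OF q(2), of "a x" "b x"] ab[OF x] ab_sum[OF x] sub by auto
    moreover have "C (a x) \<in> qN" "C (b x) \<in> qI" using st ab x by auto
    ultimately have "f (C x) = C' (P (a x)) + C' (R (b x))" using f P(3) R(3) ab x by simp
    then show ?thesis using linear_onD(1)[OF q'(2)] Pm[OF x] sub' by (simp add: f_def subset_iff)
  qed
  ultimately show ?thesis using flin unfolding similar_on_def by blast
qed

text \<open>The two components may be similar with different factors; these are reconciled on the
  nilpotent component, where every nonzero factor is admissible.\<close>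

lemma similar_up_to_scale_fitting_iff:
  assumes q: "fin_dim_space s q" "linear_on s s q C" "C ` q \<subseteq> q" "fitting_decomposition s q C qN qI"
    and q': "fin_dim_space s' q'" "linear_on s' s' q' C'" "C' ` q' \<subseteq> q'"
      "fitting_decomposition s' q' C' qN' qI'"
  shows "(\<exists>t. t \<noteq> 0 \<and> similar_on s q C s' q' (\<lambda>x. s' t (C' x))) \<longleftrightarrow>
    (\<exists>t. t \<noteq> 0 \<and> similar_on s qN C s' qN' (\<lambda>x. s' t (C' x))) \<and>
    (\<exists>t. t \<noteq> 0 \<and> similar_on s qI C s' qI' (\<lambda>x. s' t (C' x)))" (is "?L \<longleftrightarrow> ?N \<and> ?I")
proof
  interpret q': fin_dim_space s' q' by fact
  have scaled: "linear_on s' s' q' (\<lambda>x. s' t (C' x))" "(\<lambda>x. s' t (C' x)) ` q' \<subseteq> q'" for t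
    using linear_onD[OF q'(2)] q'(3) q'.carrier_closed(5)
    by (auto simp: linear_on_def q'.scale_right_distrib mult.commute)
  note F' = fitting_decomposition_scale[OF q']
  {
    assume ?L
    then obtain t where t: "t \<noteq> 0" "similar_on s q C s' q' (\<lambda>x. s' t (C' x))" by blast
    show "?N \<and> ?I"
      using similar_on_fitting[OF q q'(1) scaled F'[OF t(1)] t(2)] t(1) by blast
  }
  {
    assume "?N \<and> ?I"
    then obtain t u where t: "t \<noteq> 0" "similar_on s qN C s' qN' (\<lambda>x. s' t (C' x))"
      and u: "u \<noteq> 0" "similar_on s qI C s' qI' (\<lambda>x. s' u (C' x))" by blast
    note sub = fitting_subset[OF q'.vector_space_axioms q'(4)]
    have "fin_dim_space s' qN'"
      using q'.fin_dim_subspace fitting_decompositionD(1)[OF q'(4)] sub by blast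
    moreover obtain k where "\<And>x. x \<in> qN' \<Longrightarrow> ((\<lambda>x. s' t (C' x)) ^^ k) x = 0"
      using fitting_decompositionD(6)[OF F'[OF t(1)]] by blast
    ultimately have "similar_on s' qN' (\<lambda>x. s' t (C' x)) s' qN' (\<lambda>x. s' (u / t) (s' t (C' x)))"
      using linear_on_subset[OF scaled(1) sub(1)] fitting_decompositionD(4)[OF F'[OF t(1)]] t(1) u(1)
      by (intro similar_on_nilpotent_scale) auto
    with t(2) have "similar_on s qN C s' qN' (\<lambda>x. s' (u / t) (s' t (C' x)))"
      by (rule similar_on_trans)
    then have "similar_on s qN C s' qN' (\<lambda>x. s' u (C' x))" using t(1) by simp
    then show ?L
      using similar_on_direct_sum[OF q(1,2,4) q'(1) scaled(1) F'[OF u(1)] _ u(2)] u(1) by blast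
  }
qed

section \<open>Square roots in the algebra generated by an operator\<close>

lemma complex_quadratic_root:
  fixes a b c :: complex
  assumes "a \<noteq> 0 \<or> b \<noteq> 0"
  shows "\<exists>x. a * x ^ 2 + b * x + c = 0"
proof (cases "a = 0")
  case True
  then show ?thesis using assms by (intro exI[of _ "- c / b"]) simp
next
  case False
  define d where "d = csqrt (b ^ 2 - 4 * a * c)"
  have d: "d ^ 2 = b ^ 2 - 4 * a * c" by (simp add: d_def)
  have "a * ((d - b) / (2 * a)) ^ 2 + b * ((d - b) / (2 * a)) + c
      = (d ^ 2 - (b ^ 2 - 4 * a * c)) / (4 * a)"
    using False by (simp add: field_simps power2_eq_square)
  then show ?thesis using d by (intro exI[of _ "(d - b) / (2 * a)"]) simp
qed

text \<open>Induction on the degree of \<open>m = (X - a) m1\<close>: a square root \<open>h\<close> of the variable modulo \<open>m1\<close> is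
  corrected to \<open>h + c m1\<close> in order to gain the factor \<open>X - a\<close>. The condition on \<open>c\<close> is a quadratic
  equation, or a linear one if \<open>a\<close> is also a root of \<open>m1\<close>, in which case its leading coefficient
  \<open>2 h(a)\<close> is nonzero because \<open>h(a)\<^sup>2 = a \<noteq> 0\<close>.\<close>

lemma variable_is_square_mod:
  fixes m :: "complex poly"
  assumes "poly m 0 \<noteq> 0"
  shows "\<exists>h. m dvd h ^ 2 - [:0, 1:]"
  using assms
proof (induction "degree m" arbitrary: m)
  case 0
  then obtain c where "m = [:c:]" "c \<noteq> 0" by (metis degree_eq_zeroE poly_0 pCons_0_0)
  then show ?case using is_unit_triv unit_imp_dvd by blast
next
  case (Suc n)
  then have "\<not> constant (poly m)" by (simp add: constant_degree)
  then obtain a where a: "poly m a = 0" using fundamental_theorem_of_algebra by blast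
  then obtain m1 where m1: "m = [:- a, 1:] * m1" by (metis dvdE poly_eq_0_iff_dvd)
  have nz: "poly m1 0 \<noteq> 0" "a \<noteq> 0" using Suc.prems m1 by auto
  have "degree m = Suc (degree m1)"
    using m1 nz by (subst m1, subst degree_mult_eq) auto
  then have "n = degree m1" using Suc.hyps(2) by simp
  then obtain h k where hk: "h ^ 2 - [:0, 1:] = m1 * k"
    using Suc.hyps(1)[OF _ nz(1)] by (auto elim: dvdE)
  have "poly m1 a \<noteq> 0 \<or> 2 * poly h a \<noteq> 0"
  proof (rule ccontr)
    assume "\<not> ?thesis"
    then have "poly (h ^ 2 - [:0, 1:]) a = - a" "poly (m1 * k) a = 0" by auto
    then show False using hk nz(2) by simp
  qed
  then obtain c where c: "poly m1 a * c ^ 2 + 2 * poly h a * c + poly k a = 0"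
    using complex_quadratic_root by blast
  have eq: "(h + smult c m1) ^ 2 - [:0, 1:] = m1 * (k + smult (2 * c) h + smult (c ^ 2) m1)"
  proof (rule iffD1[OF poly_eq_poly_eq_iff], rule ext)
    fix x
    have "poly h x ^ 2 - x = poly m1 x * poly k x"
      using arg_cong[OF hk, of "\<lambda>p. poly p x"] by simp
    then show "poly ((h + smult c m1) ^ 2 - [:0, 1:]) x
        = poly (m1 * (k + smult (2 * c) h + smult (c ^ 2) m1)) x"
      by (simp add: algebra_simps power2_eq_square)
  qed
  have "poly (k + smult (2 * c) h + smult (c ^ 2) m1) a = 0" using c by (simp add: algebra_simps)
  then have "[:- a, 1:] dvd k + smult (2 * c) h + smult (c ^ 2) m1"
    by (rule iffD1[OF poly_eq_0_iff_dvd])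
  then have "m dvd (h + smult c m1) ^ 2 - [:0, 1:]"
    unfolding eq m1 by (metis mult.commute mult_dvd_mono dvd_refl)
  then show ?case by blast
qed

definition poly_map :: "(complex \<Rightarrow> 'a::ab_group_add \<Rightarrow> 'a) \<Rightarrow> ('a \<Rightarrow> 'a) \<Rightarrow> complex poly \<Rightarrow> 'a \<Rightarrow> 'a"
  where "poly_map s D p x = (\<Sum>i\<le>degree p. s (coeff p i) ((D ^^ i) x))"

locale linear_endo = Vector_Spaces.linear s s D
  for s :: "complex \<Rightarrow> 'a::ab_group_add \<Rightarrow> 'a" and D
begin

lemma poly_map_0 [simp]: "poly_map s D 0 x = 0"
  by (simp add: poly_map_def)

lemma poly_map_1 [simp]: "poly_map s D 1 x = x"
  by (simp add: poly_map_def)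

lemma poly_map_pCons [simp]: "poly_map s D (pCons a p) x = s a x + D (poly_map s D p x)"
proof (cases "p = 0")
  case False
  then show ?thesis
    by (simp add: poly_map_def sum.atMost_Suc_shift sum scale del: sum.atMost_Suc)
qed (simp add: poly_map_def)

lemma poly_map_add: "poly_map s D (p + q) x = poly_map s D p x + poly_map s D q x"
  by (induction p q rule: poly_induct2) (simp_all add: add vs1.scale_left_distrib)

lemma poly_map_smult: "poly_map s D (smult c p) x = s c (poly_map s D p x)"
  by (induction p) (simp_all add: scale vs1.scale_right_distrib)

lemma poly_map_mult: "poly_map s D (p * q) x = poly_map s D p (poly_map s D q x)"
  by (induction p) (simp_all add: poly_map_add poly_map_smult)

lemma poly_map_monom: "poly_map s D (monom c n) x = s c ((D ^^ n) x)"
  by (induction n) (simp_all add: monom_0 monom_Suc scale)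

lemma poly_map_sum: "finite A \<Longrightarrow> poly_map s D (\<Sum>i\<in>A. f i) x = (\<Sum>i\<in>A. poly_map s D (f i) x)"
  by (induction A rule: finite_induct) (simp_all add: poly_map_add)

lemma linear_poly_map: "Vector_Spaces.linear s s (poly_map s D p)"
proof (induction p)
  case 0
  show ?case by (simp add: Vector_Spaces.linear_iff vs1.vector_space_axioms)
next
  case (pCons a p)
  then show ?case
    by (simp add: Vector_Spaces.linear_iff add scale vs1.scale_right_distrib mult.commute algebra_simps)
qed

lemma poly_map_in:
  assumes "vs1.subspace V" "D ` V \<subseteq> V" "x \<in> V"
  shows "poly_map s D p x \<in> V"
  using assms
  by (induction p) (auto simp: vs1.subspace_0 vs1.subspace_add vs1.subspace_scale)

lemma poly_map_commute:
  assumes "linear_on s s V T" "vs1.subspace V" "D ` V \<subseteq> V" "T ` V \<subseteq> V"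
    and "\<And>x. x \<in> V \<Longrightarrow> T (D x) = D (T x)" and x: "x \<in> V"
  shows "T (poly_map s D p x) = poly_map s D p (T x)"
proof (induction p)
  case 0
  show ?case using linear_onD(2)[OF assms(1), of 0 0] vs1.subspace_0[OF assms(2)] by simp
next
  case (pCons a p)
  have "poly_map s D p x \<in> V" by (rule poly_map_in[OF assms(2,3) x])
  moreover have "D (poly_map s D p x) \<in> V" using calculation assms(3) by blast
  moreover have "s a x \<in> V" using x vs1.subspace_scale[OF assms(2)] by blast
  ultimately show ?case
    using pCons linear_onD[OF assms(1)] assms(5) x by simp
qed

lemma poly_map_annihilates_vector:
  assumes "fin_dim_space s V" "D ` V \<subseteq> V" "v \<in> V"
  shows "\<exists>p. p \<noteq> 0 \<and> poly_map s D p v = 0"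
proof -
  interpret V: fin_dim_space s V by fact
  obtain b where b: "finite b" "vs1.independent b" "V = vs1.span b" "b \<subseteq> V" by (rule V.carrier_basis)
  have mem: "(D ^^ i) v \<in> V" for i using assms(2,3) by (induction i) auto
  show ?thesis
  proof (cases "inj_on (\<lambda>i. (D ^^ i) v) {..card b}")
    case False
    then obtain i j where ij: "i \<noteq> j" "(D ^^ i) v = (D ^^ j) v" by (auto simp: inj_on_def)
    have "coeff (monom 1 i + monom (-1) j :: complex poly) i \<noteq> 0" using ij(1) by simp
    then have "(monom 1 i + monom (-1) j :: complex poly) \<noteq> 0" by (metis coeff_0)
    moreover have "poly_map s D (monom 1 i + monom (-1) j) v = 0"
      using ij(2) by (simp add: poly_map_add poly_map_monom)
    ultimately show ?thesis by blast
  next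
    case True
    let ?A = "(\<lambda>i. (D ^^ i) v) ` {..card b}"
    have "card ?A = Suc (card b)" using True by (simp add: card_image)
    then have "vs1.dependent ?A" using vs1.independent_span_bound[OF b(1), of ?A] mem b(3) by auto
    then obtain u w where u: "w \<in> ?A" "u w \<noteq> 0" "(\<Sum>x\<in>?A. s (u x) x) = 0"
      using vs1.dependent_finite[of ?A] by auto
    define p where "p = (\<Sum>i\<le>card b. monom (u ((D ^^ i) v)) i)"
    have "coeff p i = u ((D ^^ i) v)" if "i \<le> card b" for i
      using that by (simp add: p_def coeff_sum)
    then have "p \<noteq> 0" using u(1,2) by auto
    moreover have "poly_map s D p v = 0"
      using u(3) by (simp add: p_def poly_map_sum poly_map_monom sum.reindex[OF True])
    ultimately show ?thesis by blast
  qed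
qed

lemma poly_map_annihilates:
  assumes V: "fin_dim_space s V" "D ` V \<subseteq> V"
  shows "\<exists>p. p \<noteq> 0 \<and> (\<forall>v\<in>V. poly_map s D p v = 0)"
proof -
  interpret V: fin_dim_space s V by fact
  obtain b where b: "finite b" "vs1.independent b" "V = vs1.span b" "b \<subseteq> V" by (rule V.carrier_basis)
  have "\<exists>p. p \<noteq> 0 \<and> (\<forall>v\<in>b. poly_map s D p v = 0)"
    using b(1,4)
  proof (induction b rule: finite_induct)
    case empty
    show ?case by (intro exI[of _ 1]) simp
  next
    case (insert x F)
    then obtain p where p: "p \<noteq> 0" "\<forall>v\<in>F. poly_map s D p v = 0" by auto
    obtain q where q: "q \<noteq> 0" "poly_map s D q x = 0"
      using poly_map_annihilates_vector[OF V] insert.prems by blast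
    interpret pp: vector_space_pair s s ..
    note poly_map_zero = pp.linear_0[OF linear_poly_map]
    have "poly_map s D (p * q) x = 0" using q(2) by (simp add: poly_map_mult poly_map_zero)
    moreover have "poly_map s D (p * q) v = 0" if "v \<in> F" for v
      using p(2) that poly_map_mult[of q p v] poly_map_zero by (simp add: mult.commute)
    ultimately show ?case using p(1) q(1) by (intro exI[of _ "p * q"]) auto
  qed
  then obtain p where p: "p \<noteq> 0" "\<And>v. v \<in> b \<Longrightarrow> poly_map s D p v = 0" by auto
  interpret pp: vector_space_pair s s ..
  have "poly_map s D p v = 0" if "v \<in> vs1.span b" for v
    using pp.linear_eq_0_on_span[OF linear_poly_map p(2) that] .
  then have "\<forall>v\<in>V. poly_map s D p v = 0" using b(3) by simp
  then show ?thesis using p(1) by (intro exI[of _ p] conjI)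
qed

text \<open>As \<open>D\<close> is injective, powers of the variable can be cancelled from an annihilating polynomial.
  Modulo the remaining factor the variable, and hence \<open>D\<close>, is a square.\<close>

lemma exists_square_root_poly:
  assumes V: "fin_dim_space s V" "D ` V \<subseteq> V" and inj: "inj_on D V"
  shows "\<exists>h. \<forall>v\<in>V. poly_map s D h (poly_map s D h v) = D v"
proof -
  interpret V: fin_dim_space s V by fact
  obtain p where p: "p \<noteq> 0" "\<forall>v\<in>V. poly_map s D p v = 0"
    using poly_map_annihilates[OF V] by (elim exE conjE)
  obtain n m where m: "p = [:0, 1:] ^ n * m" and m0: "poly m 0 \<noteq> 0"
  proof -
    obtain m where m: "p = [:- 0, 1:] ^ order 0 p * m" "\<not> [:- 0, 1:] dvd m"
      using order_decomp[OF p(1), of 0] by (elim exE conjE)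
    have "poly m 0 \<noteq> 0" using m(2) iffD1[OF poly_eq_0_iff_dvd] by metis
    then show ?thesis using that[OF m(1)[unfolded minus_zero]] by simp
  qed
  have D0: "x = 0" if "x \<in> V" "D x = 0" for x
    using inj V.inj_on_linear_on_iff[OF vs1.vector_space_axioms linear_imp_linear_on[OF linear_axioms]] that
    by simp
  have pow0: "x = 0" if "x \<in> V" "poly_map s D ([:0, 1:] ^ n) x = 0" for x n
    using that
  proof (induction n arbitrary: x)
    case (Suc n)
    have "poly_map s D ([:0, 1:] ^ n) (poly_map s D [:0, 1:] x) = 0"
      using Suc.prems(2) unfolding power_Suc2 poly_map_mult .
    moreover have "poly_map s D [:0, 1:] x = D x" by simp
    ultimately have "D x = 0" using Suc.IH[of "D x"] Suc.prems(1) V by auto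
    then show ?case using D0 Suc.prems(1) by blast
  qed simp
  have ann: "poly_map s D m v = 0" if "v \<in> V" for v
  proof (rule pow0)
    show "poly_map s D m v \<in> V" by (rule poly_map_in[OF V.subspace_carrier V(2) that])
    show "poly_map s D ([:0, 1:] ^ n) (poly_map s D m v) = 0"
      using p(2)[rule_format, OF that] unfolding m poly_map_mult .
  qed
  obtain h k where hk: "h ^ 2 - [:0, 1:] = m * k" using variable_is_square_mod[OF m0] by (metis dvdE)
  interpret pp: vector_space_pair s s ..
  have "poly_map s D h (poly_map s D h v) = D v" if "v \<in> V" for v
  proof -
    have "h * h = m * k + [:0, 1:]" using hk by (simp add: power2_eq_square algebra_simps)
    then have "poly_map s D h (poly_map s D h v) = poly_map s D (k * m) v + poly_map s D [:0, 1:] v"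
      unfolding poly_map_mult[symmetric] by (simp only: poly_map_add mult.commute[of k m])
    moreover have "poly_map s D (k * m) v = 0"
      using ann[OF that] pp.linear_0[OF linear_poly_map] by (simp add: poly_map_mult)
    ultimately show ?thesis by simp
  qed
  then show ?thesis by (intro exI[of _ h] ballI)
qed

end

section \<open>Correcting a similarity of skew-symmetric operators to an isometry\<close>

lemma bilinear_onD:
  assumes "bilinear_on s s' V B"
  shows "\<And>x y z. x \<in> V \<Longrightarrow> y \<in> V \<Longrightarrow> z \<in> V \<Longrightarrow> B (x + y) z = B x z + B y z"
    "\<And>x y z. x \<in> V \<Longrightarrow> y \<in> V \<Longrightarrow> z \<in> V \<Longrightarrow> B z (x + y) = B z x + B z y"
    "\<And>c x y. x \<in> V \<Longrightarrow> y \<in> V \<Longrightarrow> B (s c x) y = s' c (B x y)"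
    "\<And>c x y. x \<in> V \<Longrightarrow> y \<in> V \<Longrightarrow> B y (s c x) = s' c (B y x)"
  using assms by (auto simp: bilinear_on_def linear_on_def)

text \<open>The operator comparing a second form with a non-degenerate one. Both forms are encoded by
  their values against a basis, which turns the representation of functionals into the
  invertibility of an injective endomorphism.\<close>

lemma (in quadratic_space) form_represented:
  assumes B': "bilinear_on s (*) V B'"
  obtains D where "Vector_Spaces.linear s s D" "D ` V \<subseteq> V"
    "\<And>x y. x \<in> V \<Longrightarrow> y \<in> V \<Longrightarrow> B (D x) y = B' x y"
proof -
  obtain b where b: "finite b" "independent b" "V = span b" "b \<subseteq> V" by (rule carrier_basis)
  define L where "L = (\<lambda>(F :: 'a \<Rightarrow> 'a \<Rightarrow> complex) x. \<Sum>e\<in>b. s (F x e) e)"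
  have L: "linear_on s s V (L F)" "L F ` V \<subseteq> V" if F: "bilinear_on s (*) V F" for F
  proof -
    have "F (x + y) e = F x e + F y e" "F (s c x) e = c * F x e" if "x \<in> V" "y \<in> V" "e \<in> b" for x y e c
      using bilinear_onD[OF F] that b(4) by auto
    then show "linear_on s s V (L F)"
      by (simp add: linear_on_def L_def scale_left_distrib sum.distrib scale_sum_right)
    have "L F x \<in> span b" for x unfolding L_def by (intro span_sum span_scale span_base)
    then show "L F ` V \<subseteq> V" using b(3) by blast
  qed
  have determined: "F x y = G x' y"
    if FG: "bilinear_on s (*) V F" "bilinear_on s (*) V G" and eqL: "L F x = L G x'"
      and mem: "x \<in> V" "x' \<in> V" "y \<in> V" for F G x x' y
  proof -
    have "(\<Sum>e\<in>b. s (F x e - G x' e) e) = 0"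
      using eqL by (simp add: L_def scale_left_diff_distrib sum_subtractf)
    then have eq: "F x e = G x' e" if "e \<in> b" for e
      using independentD[OF b(2,1) order_refl _ that] by force
    have "y \<in> V \<and> F x y = G x' y" if "y \<in> span b" for y
      using that
    proof (induction rule: span_induct_alt)
      case base
      show ?case
        using bilinear_onD(4)[OF FG(1), of 0 x 0] bilinear_onD(4)[OF FG(2), of 0 x' 0] mem carrier_closed(1)
        by simp
    next
      case (step c e y)
      then have "e \<in> V" "y \<in> V" using b(4) by auto
      then show ?case
        using step eq bilinear_onD(2,4)[OF FG(1)] bilinear_onD(2,4)[OF FG(2)] mem carrier_closed(2,5)
        by simp
    qed
    then show ?thesis using mem(3) b(3) by blast
  qed
  note LB = L[OF form_bilinear]
  have injL: "inj_on (L B) V"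
  proof (subst inj_on_linear_on_iff[OF vector_space_axioms LB(1)], intro ballI impI)
    fix x assume x: "x \<in> V" "L B x = 0"
    have L0: "L B 0 = 0" using linear_on_diff_zero(1)[OF vector_space_axioms LB(1)] .
    have "B x y = B 0 y" if "y \<in> V" for y
      by (rule determined[OF form_bilinear form_bilinear _ x(1) carrier_closed(1) that]) (simp only: x(2) L0)
    moreover have "B 0 y = 0" if "y \<in> V" for y
      using bilinear_onD(3)[OF form_bilinear, of 0 y 0] that carrier_closed(1) by simp
    ultimately show "x = 0" using form_nondegenerate[OF x(1)] by simp
  qed
  have im: "L B ` V = V" by (rule inj_endo_surj[OF LB injL])
  have bij: "bij_betw (L B) V V" using injL im by (simp add: bij_betw_def)
  define D0 where "D0 = (\<lambda>x. the_inv_into V (L B) (L B' x))"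
  have "linear_on s s V D0"
    unfolding D0_def
    using linear_on_compose[OF L(1)[OF B'] linear_on_the_inv_into[OF fin_dim_space_axioms LB(1) bij] L(2)[OF B']] .
  then obtain D where D: "Vector_Spaces.linear s s D" "\<And>x. x \<in> V \<Longrightarrow> D x = D0 x"
    using linear_on_extend[OF vector_space_axioms] by blast
  have D0: "D0 x \<in> V" "L B (D0 x) = L B' x" if "x \<in> V" for x
  proof -
    have "L B' x \<in> L B ` V" using L(2)[OF B'] im that by blast
    then show "D0 x \<in> V" "L B (D0 x) = L B' x"
      using the_inv_into_into[OF injL _ order_refl] f_the_inv_into_f[OF injL] by (auto simp: D0_def)
  qed
  show ?thesis
  proof (rule that[OF D(1)])
    show "D ` V \<subseteq> V" using D0(1) D(2) by auto
    show "B (D x) y = B' x y" if "x \<in> V" "y \<in> V" for x y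
      using determined[OF form_bilinear B' D0(2)[OF that(1)] D0(1)[OF that(1)] that] D(2)[OF that(1)] by simp
  qed
qed

lemma (in quadratic_space) form_eqI:
  assumes "x \<in> V" "x' \<in> V" "\<And>y. y \<in> V \<Longrightarrow> B x y = B x' y"
  shows "x = x'"
proof -
  have "B (x - x') y = 0" if "y \<in> V" for y
  proof -
    have "linear_on s (*) V (\<lambda>x. B x y)" using form_bilinear that by (simp add: bilinear_on_def)
    then have "B (x - x') y = B x y - B x' y"
      using linear_onD(1)[of s "(*)" V "\<lambda>x. B x y" "x - x'" x'] assms(1,2) carrier_closed(3) by auto
    then show ?thesis using assms(3) that by simp
  qed
  then have "x - x' = 0" using form_nondegenerate carrier_closed(3) assms(1,2) by blast
  then show ?thesis by simp
qed

text \<open>The operator \<open>D\<close> with \<open>B (D x) y = B' x y\<close> is self-adjoint, invertible and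
  commutes with \<open>C\<close>; a square root of \<open>D\<close> that is a polynomial in \<open>D\<close> inherits all of this.\<close>

lemma (in quadratic_space) commuting_change_of_form:
  assumes Q': "quadratic_space s V B'" and C: "skew_map s V B C" and C': "skew_map s V B' C"
  obtains S where "linear_on s s V S" "bij_betw S V V"
    "\<And>x. x \<in> V \<Longrightarrow> S (C x) = C (S x)" "\<And>x y. x \<in> V \<Longrightarrow> y \<in> V \<Longrightarrow> B (S x) (S y) = B' x y"
proof -
  interpret Q': quadratic_space s V B' by fact
  obtain D where D: "Vector_Spaces.linear s s D" "D ` V \<subseteq> V"
    and DB: "\<And>x y. x \<in> V \<Longrightarrow> y \<in> V \<Longrightarrow> B (D x) y = B' x y"
    using form_represented[OF Q'.form_bilinear] by blast
  interpret D: linear_endo s D by (rule linear_endo.intro[OF D(1)])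
  have DV: "D x \<in> V" if "x \<in> V" for x using that D(2) by blast
  have CV: "C ` V \<subseteq> V" "linear_on s s V C" using C by (auto simp: skew_map_def)
  have CV': "C x \<in> V" if "x \<in> V" for x using that CV(1) by blast
  have self_adjoint: "B (D x) y = B x (D y)" if "x \<in> V" "y \<in> V" for x y
    using DB that form_sym Q'.form_sym DV by metis
  have commute: "C (D x) = D (C x)" if x: "x \<in> V" for x
  proof (rule form_eqI)
    show "C (D x) \<in> V" "D (C x) \<in> V" using x DV CV' by auto
    fix y assume y: "y \<in> V"
    have "B (C (D x)) y = - B (D x) (C y)" using C x y DV by (auto simp: skew_map_def)
    also have "\<dots> = B' (C x) y" using C' x y DB CV' by (auto simp: skew_map_def)
    finally show "B (C (D x)) y = B (D (C x)) y" using DB x y CV' by simp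
  qed
  have inj: "inj_on D V"
  proof (rule inj_onI)
    fix x y assume xy: "x \<in> V" "y \<in> V" "D x = D y"
    have "B' x z = B' y z" if "z \<in> V" for z
      using DB[OF xy(1) that] DB[OF xy(2) that] xy(3) by simp
    then show "x = y" using Q'.form_eqI xy(1,2) by blast
  qed
  obtain h where "\<forall>v\<in>V. poly_map s D h (poly_map s D h v) = D v"
    using D.exists_square_root_poly[OF fin_dim_space_axioms D(2) inj] by (elim exE)
  note h = this[rule_format]
  define S where "S = poly_map s D h"
  have SV: "S x \<in> V" if "x \<in> V" for x
    unfolding S_def by (rule D.poly_map_in[OF subspace_carrier D(2) that])
  have adj: "B (poly_map s D p x) y = B x (poly_map s D p y)" if "x \<in> V" "y \<in> V" for p x y
    using that(2)
  proof (induction p arbitrary: y)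
    case 0
    show ?case
      using bilinear_onD(3)[OF form_bilinear, of 0 y 0] bilinear_onD(4)[OF form_bilinear, of 0 x 0]
        \<open>x \<in> V\<close> 0 carrier_closed(1) by simp
  next
    case (pCons a p)
    have P: "poly_map s D p z \<in> V" if "z \<in> V" for z
      by (rule D.poly_map_in[OF subspace_carrier D(2) that])
    have "D (poly_map s D p y) = poly_map s D p (D y)"
      by (rule D.poly_map_commute[OF linear_imp_linear_on[OF D(1)] subspace_carrier D(2) D(2) refl pCons.prems])
    then have "B (D (poly_map s D p x)) y = B x (D (poly_map s D p y))"
      using self_adjoint[OF P[OF \<open>x \<in> V\<close>] pCons.prems] pCons.IH[OF DV[OF pCons.prems]] by simp
    then show ?case
      using \<open>x \<in> V\<close> pCons.prems P DV carrier_closed(5) by (simp add: bilinear_onD[OF form_bilinear])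
  qed
  have lin: "linear_on s s V S" unfolding S_def by (rule linear_imp_linear_on[OF D.linear_poly_map])
  have injS: "inj_on S V"
  proof (rule inj_onI)
    fix x y assume xy: "x \<in> V" "y \<in> V" "S x = S y"
    then have "D x = D y" using h[OF xy(1)] h[OF xy(2)] by (simp add: S_def)
    then show "x = y" using inj xy by (simp add: inj_on_def)
  qed
  have "S ` V = V" using inj_endo_surj[OF lin _ injS] SV by blast
  then have "bij_betw S V V" using injS by (simp add: bij_betw_def)
  moreover have "S (C x) = C (S x)" if "x \<in> V" for x
    unfolding S_def using D.poly_map_commute[OF CV(2) subspace_carrier D(2) CV(1) commute that] by simp
  moreover have "B (S x) (S y) = B' x y" if "x \<in> V" "y \<in> V" for x y
    using adj[OF that(1) SV[OF that(2)], of h] h that DB self_adjoint by (simp add: S_def)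
  ultimately show ?thesis using that lin by blast
qed

text \<open>This is a polar decomposition. If \<open>P C = C' P\<close>, then \<open>C\<close> is skew-symmetric both for \<open>B\<close> and for
  the pullback of \<open>B'\<close> along \<open>P\<close>. With \<open>S\<close> commuting with \<open>C\<close> and carrying the one form to the
  other, the isometric similarity is \<open>P S\<^sup>-\<^sup>1\<close>.\<close>

lemma isometric_similarity:
  assumes Q: "quadratic_space s q B" and Q': "quadratic_space s' q' B'"
    and C: "skew_map s q B C" and C': "skew_map s' q' B' C'"
    and sim: "similar_on s q C s' q' C'"
  obtains A where "linear_on s s' q A" "bij_betw A q q'" "\<And>x. x \<in> q \<Longrightarrow> A (C x) = C' (A x)"
    "\<And>x y. x \<in> q \<Longrightarrow> y \<in> q \<Longrightarrow> B' (A x) (A y) = B x y"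
proof -
  interpret Q: quadratic_space s q B by fact
  interpret Q': quadratic_space s' q' B' by fact
  obtain P where P: "linear_on s s' q P" "bij_betw P q q'" "\<And>x. x \<in> q \<Longrightarrow> P (C x) = C' (P x)"
    using sim by (auto simp: similar_on_def)
  have im: "P ` q = q'" and inj: "inj_on P q" using P(2) by (auto simp: bij_betw_def)
  have Pq: "P x \<in> q'" if "x \<in> q" for x using that im by blast
  have Cq: "C x \<in> q" if "x \<in> q" for x using C that by (auto simp: skew_map_def)
  let ?B = "\<lambda>x y. B' (P x) (P y)"
  have bil: "bilinear_on s (*) q ?B"
    using Pq by (simp add: bilinear_on_def linear_on_def linear_onD[OF P(1)] bilinear_onD[OF Q'.form_bilinear])
  have "quadratic_space s q ?B"
  proof (unfold_locales, rule bil)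
    show "?B x y = ?B y x" if "x \<in> q" "y \<in> q" for x y using Q'.form_sym Pq that by simp
    fix x assume x: "x \<in> q" "\<And>y. y \<in> q \<Longrightarrow> ?B x y = 0"
    then have "P x = 0" using Q'.form_nondegenerate[of "P x"] Pq im by blast
    then show "x = 0"
      using inj Q.inj_on_linear_on_iff[OF Q'.vector_space_axioms P(1)] x(1) by blast
  qed
  moreover have "skew_map s q ?B C"
    using C C' Pq P(3) by (simp add: skew_map_def)
  ultimately obtain S where S: "linear_on s s q S" "bij_betw S q q"
      "\<And>x. x \<in> q \<Longrightarrow> S (C x) = C (S x)" "\<And>x y. x \<in> q \<Longrightarrow> y \<in> q \<Longrightarrow> B (S x) (S y) = ?B x y"
    using Q.commuting_change_of_form[OF _ C, of ?B] by blast
  let ?T = "the_inv_into q S"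
  have T: "linear_on s s q ?T" "bij_betw ?T q q"
    using linear_on_the_inv_into[OF Q.fin_dim_space_axioms S(1,2)] bij_betw_the_inv_into[OF S(2)] .
  have ST: "?T x \<in> q" "S (?T x) = x" "?T (S x) = x" if "x \<in> q" for x
    using S(2) that T(2) by (auto simp: bij_betw_def f_the_inv_into_f the_inv_into_f_f)
  have com: "?T (C x) = C (?T x)" if x: "x \<in> q" for x
    using ST S(3)[of "?T x"] Cq x by metis
  show ?thesis
  proof (rule that[of "\<lambda>x. P (?T x)"])
    show "linear_on s s' q (\<lambda>x. P (?T x))"
      using linear_on_compose[OF T(1) P(1)] ST(1) by blast
    show "bij_betw (\<lambda>x. P (?T x)) q q'" using bij_betw_trans[OF T(2) P(2)] by (simp add: o_def)
    show "P (?T (C x)) = C' (P (?T x))" if "x \<in> q" for x using com P(3) ST(1) that by simp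
    show "B' (P (?T x)) (P (?T y)) = B x y" if "x \<in> q" "y \<in> q" for x y
      using S(4)[OF ST(1)[OF that(1)] ST(1)[OF that(2)]] ST(2) that by simp
  qed
qed

section \<open>Isomorphisms of double extensions\<close>

lemma skew_map_scale:
  assumes "quadratic_space s q B" "skew_map s q B C"
  shows "skew_map s q B (\<lambda>x. s t (C x))"
proof -
  interpret quadratic_space s q B by fact
  have C: "linear_on s s q C" "\<And>x. x \<in> q \<Longrightarrow> C x \<in> q" "\<And>x y. x \<in> q \<Longrightarrow> y \<in> q \<Longrightarrow> B (C x) y = - B x (C y)"
    using assms(2) by (auto simp: skew_map_def)
  have "linear_on s s q (\<lambda>x. s t (C x))"
    using linear_onD[OF C(1)] by (simp add: linear_on_def scale_right_distrib mult.commute)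
  then show ?thesis
    using C(2,3) carrier_closed(5) bilinear_onD(3,4)[OF form_bilinear]
    by (simp add: skew_map_def image_subset_iff)
qed

locale double_extension_space = V: quadratic_space s V B + q: quadratic_space s q B
  for s :: "complex \<Rightarrow> 'a::ab_group_add \<Rightarrow> 'a" and V B q +
  fixes br :: "'a \<Rightarrow> 'a \<Rightarrow> 'a" and X0 Y0 :: 'a and C :: "'a \<Rightarrow> 'a"
  assumes dext: "double_extension s V br B X0 Y0 q C"
begin

lemma skew: "skew_map s q B C"
  and carrier: "V = plane_sum s X0 Y0 q"
  using dext by (auto simp: double_extension_def)

lemma bracket:
  "x \<in> q \<Longrightarrow> y \<in> q \<Longrightarrow>
    br (x + s l X0 + s m Y0) (y + s l' X0 + s m' Y0) = s m (C y) - s m' (C x) + s (B (C x) y) X0"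
  using dext by (auto simp: double_extension_def)

lemma C_linear: "linear_on s s q C" "C ` q \<subseteq> q" "x \<in> q \<Longrightarrow> C x \<in> q"
  and C_skew: "x \<in> q \<Longrightarrow> y \<in> q \<Longrightarrow> B (C x) y = - B x (C y)"
  using skew by (auto simp: skew_map_def)

lemma in_V: "x \<in> q \<Longrightarrow> x + s l X0 + s m Y0 \<in> V"
  unfolding carrier plane_sum_def by blast

lemma plane_in_V: "X0 \<in> V" "Y0 \<in> V"
  using in_V[OF q.carrier_closed(1), of 1 0] in_V[OF q.carrier_closed(1), of 0 1] by auto

lemma q_in_V: "x \<in> q \<Longrightarrow> x \<in> V"
  using in_V[of x 0 0] by simp

lemma form_plane:
  "B X0 X0 = 0" "B Y0 Y0 = 0" "B X0 Y0 = 1" "B Y0 X0 = 1"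
  "x \<in> q \<Longrightarrow> B X0 x = 0" "x \<in> q \<Longrightarrow> B Y0 x = 0" "x \<in> q \<Longrightarrow> B x X0 = 0" "x \<in> q \<Longrightarrow> B x Y0 = 0"
proof -
  show *: "B X0 X0 = 0" "B Y0 Y0 = 0" "B X0 Y0 = 1"
    "x \<in> q \<Longrightarrow> B X0 x = 0" "x \<in> q \<Longrightarrow> B Y0 x = 0"
    using dext by (auto simp: double_extension_def)
  show "B Y0 X0 = 1" using * V.form_sym plane_in_V by metis
  show "x \<in> q \<Longrightarrow> B x X0 = 0" "x \<in> q \<Longrightarrow> B x Y0 = 0"
    using * V.form_sym plane_in_V q_in_V by metis+
qed

lemmas B_linear = bilinear_onD[OF V.form_bilinear]

lemma form_coordinates:
  assumes "x \<in> q" "y \<in> q"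
  shows "B (x + s l X0 + s m Y0) (y + s l' X0 + s m' Y0) = B x y + l * m' + m * l'"
  using assms q_in_V plane_in_V V.carrier_closed(2,5)
  by (simp add: B_linear form_plane)

lemma coordinates:
  assumes "x \<in> q"
  shows "B (x + s l X0 + s m Y0) X0 = m" "B (x + s l X0 + s m Y0) Y0 = l"
  using form_coordinates[OF assms q.carrier_closed(1), of l m 1 0]
    form_coordinates[OF assms q.carrier_closed(1), of l m 0 1]
    bilinear_onD(4)[OF q.form_bilinear, of 0 x 0] assms q.carrier_closed(1) by auto

definition proj :: "'a \<Rightarrow> 'a" where "proj z = z - s (B z Y0) X0 - s (B z X0) Y0"

lemma proj_coordinates [simp]: "x \<in> q \<Longrightarrow> proj (x + s l X0 + s m Y0) = x"
  by (simp add: proj_def coordinates)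

lemma decompose:
  assumes "z \<in> V"
  obtains x l m where "x \<in> q" "z = x + s l X0 + s m Y0"
  using assms unfolding carrier plane_sum_def by blast

lemma linear_proj: "linear_on s s V proj"
proof -
  have "proj (x + y) = proj x + proj y" if "x \<in> V" "y \<in> V" for x y
    using that plane_in_V by (simp add: proj_def B_linear V.scale_left_distrib)
  moreover have "proj (s c x) = s c (proj x)" if "x \<in> V" for c x
    using that plane_in_V by (simp add: proj_def B_linear V.scale_right_diff_distrib)
  ultimately show ?thesis by (simp add: linear_on_def)
qed

lemma ad_Y0: "x \<in> q \<Longrightarrow> br Y0 (x + s l X0 + s m Y0) = C x"
  using bracket[OF q.carrier_closed(1), of x 0 1 l m]
    q.linear_on_diff_zero(1)[OF V.vector_space_axioms C_linear(1)]
    bilinear_onD(3)[OF q.form_bilinear, of 0 x 0] q.carrier_closed(1) by simp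

lemma ad_Y0_eq: "z \<in> V \<Longrightarrow> br Y0 z = C (proj z)"
  by (erule decompose) (simp add: ad_Y0)

lemma ad_Y0_q: "x \<in> q \<Longrightarrow> br Y0 x = C x"
  using ad_Y0[of x 0 0] by simp

lemma proj_in: "z \<in> V \<Longrightarrow> proj z \<in> q"
  by (erule decompose) simp

lemma linear_ad_Y0: "linear_on s s V (\<lambda>z. s t (br Y0 z))" "(\<lambda>z. s t (br Y0 z)) ` V \<subseteq> q"
proof -
  have "linear_on s s V (\<lambda>z. s t (C (proj z)))"
    using linear_onD[OF linear_proj] linear_onD[OF C_linear(1)] proj_in
    by (simp add: linear_on_def V.scale_right_distrib mult.commute)
  then show "linear_on s s V (\<lambda>z. s t (br Y0 z))"
    using ad_Y0_eq V.carrier_closed(2,5) by (simp add: linear_on_def)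
  show "(\<lambda>z. s t (br Y0 z)) ` V \<subseteq> q"
    using ad_Y0_eq proj_in C_linear(3) q.carrier_closed(5) by auto
qed

text \<open>Let \<open>m = B Z X0\<close> and let \<open>u\<close> be the component of \<open>Z\<close> in \<open>q\<close>. There is an
  isometric automorphism that fixes \<open>X0\<close>, sends \<open>y \<in> q\<close> to \<open>y - (B u y / m) X0\<close>, and sends \<open>Y0\<close> to
  \<open>Y0 + u / m\<close> up to a multiple of \<open>X0\<close>; it moves \<open>m Y0\<close> to \<open>Z\<close> modulo the central element \<open>X0\<close>.
  The map \<open>\<psi>\<close> below is this automorphism without the last multiple of \<open>X0\<close>, on which the adjoint
  operators do not depend.\<close>

lemma ad_similar:
  assumes Z: "Z \<in> V" "B Z X0 \<noteq> 0"
  shows "similar_on s V (\<lambda>z. s (B Z X0) (br Y0 z)) s V (br Z)"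
proof -
  obtain u l m where u: "u \<in> q" and Zeq: "Z = u + s l X0 + s m Y0" using Z(1) by (rule decompose)
  have m: "B Z X0 = m" "m \<noteq> 0" using coordinates(1)[OF u] Z(2) by (auto simp: Zeq)
  define \<psi> where "\<psi> = (\<lambda>z. z + s (B z X0 / m) u - s (B u z / m) X0)"
  note uV = q_in_V[OF u]
  have "\<psi> (x + y) = \<psi> x + \<psi> y" if "x \<in> V" "y \<in> V" for x y
    using that plane_in_V uV
    by (simp add: \<psi>_def B_linear V.scale_left_distrib add_divide_distrib algebra_simps)
  moreover have "\<psi> (s c x) = s c (\<psi> x)" if "x \<in> V" for c x
    using that plane_in_V uV
    by (simp add: \<psi>_def B_linear V.scale_right_distrib V.scale_right_diff_distrib)
  ultimately have lin: "linear_on s s V \<psi>" by (simp add: linear_on_def)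
  have val: "\<psi> (y + s a X0 + s b Y0) = (y + s (b / m) u) + s (a - B u y / m) X0 + s b Y0"
    if y: "y \<in> q" for y a b
  proof -
    have "B u (y + s a X0 + s b Y0) = B u y"
      using form_coordinates[OF u y, of 0 0 a b] by simp
    then show ?thesis
      using coordinates[OF y] by (simp add: \<psi>_def V.scale_left_diff_distrib algebra_simps)
  qed
  have in_q: "y + s c u \<in> q" if "y \<in> q" for y c using that u q.carrier_closed(2,5) by blast
  have \<psi>V: "\<psi> ` V \<subseteq> V"
    using val in_V in_q by (auto elim!: decompose)
  have "inj_on \<psi> V"
  proof (subst V.inj_on_linear_on_iff[OF V.vector_space_axioms lin], intro ballI impI)
    fix z assume z: "z \<in> V" "\<psi> z = 0"
    obtain y a b where y: "y \<in> q" "z = y + s a X0 + s b Y0" using z(1) by (rule decompose)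
    have eq: "(y + s (b / m) u) + s (a - B u y / m) X0 + s b Y0 = 0" using z(2) y val by simp
    have "B 0 X0 = 0" "B 0 Y0 = 0"
      using B_linear(3)[of 0 X0 0] B_linear(3)[of 0 Y0 0] plane_in_V V.carrier_closed(1) by auto
    then have b: "b = 0" and a: "a - B u y / m = 0"
      using coordinates[OF in_q[OF y(1)], of "b / m" "a - B u y / m" b] eq by auto
    have "y = 0" using eq a b by simp
    moreover have "B u 0 = 0" using B_linear(4)[of 0 u 0] uV V.carrier_closed(1) by simp
    ultimately show "z = 0" using a b y(2) by simp
  qed
  then have "bij_betw \<psi> V V" using V.inj_endo_surj[OF lin \<psi>V] by (simp add: bij_betw_def)
  moreover have "\<psi> (s m (br Y0 z)) = br Z (\<psi> z)" if zV: "z \<in> V" for z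
  proof -
    obtain y a b where y: "y \<in> q" and z: "z = y + s a X0 + s b Y0" using zV by (rule decompose)
    have "B (C u) u = - B (C u) u" using C_skew[OF u u] q.form_sym[OF u C_linear(3)[OF u]] by simp
    then have isotropic: "B (C u) u = 0" by simp
    have "\<psi> (s m (br Y0 z)) = s m (C y) - s (B u (C y)) X0"
      using val[of "s m (C y)" 0 0] C_linear(3)[OF y] q.carrier_closed(5) m(2) u
        bilinear_onD(4)[OF q.form_bilinear]
      by (simp add: z ad_Y0[OF y])
    also have "B u (C y) = - B (C u) y" using C_skew[OF u y] by simp
    finally have 1: "\<psi> (s m (br Y0 z)) = s m (C y) + s (B (C u) y) X0" by simp
    have "br Z (\<psi> z) = s m (C (y + s (b / m) u)) - s b (C u) + s (B (C u) (y + s (b / m) u)) X0"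
      unfolding z val[OF y] Zeq by (rule bracket[OF u in_q[OF y]])
    also have "C (y + s (b / m) u) = C y + s (b / m) (C u)"
      using linear_onD[OF C_linear(1)] y u q.carrier_closed(5) by simp
    also have "B (C u) (y + s (b / m) u) = B (C u) y"
      using bilinear_onD(2,4)[OF q.form_bilinear] y u q.carrier_closed(5) C_linear(3) isotropic by simp
    finally show ?thesis using 1 m(2) by (simp add: V.scale_right_distrib)
  qed
  ultimately show ?thesis using lin unfolding similar_on_def m(1) by (intro exI[of _ \<psi>]) simp
qed

text \<open>The orthogonal complement of \<open>X0\<close>. It lies between \<open>q\<close> and \<open>V\<close>, with codimension one at each
  step, so that the plane can be cancelled one line at a time.\<close>

definition hyperplane :: "'a set" where "hyperplane = {x + s a X0 | x a. x \<in> q}"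

lemma hyperplane_facts:
  "V.subspace hyperplane" "V = {x + s b Y0 | x b. x \<in> hyperplane}" "Y0 \<notin> hyperplane" "X0 \<notin> q"
  "q \<subseteq> hyperplane" "hyperplane \<subseteq> V"
proof -
  have mem: "x + s a X0 \<in> hyperplane" if "x \<in> q" for x a
    using that by (auto simp: hyperplane_def)
  show "V.subspace hyperplane"
  proof (rule V.subspaceI)
    show "0 \<in> hyperplane" using mem[OF q.carrier_closed(1), of 0] by simp
    fix u v assume "u \<in> hyperplane" "v \<in> hyperplane"
    then obtain x a y b where "x \<in> q" "y \<in> q" "u = x + s a X0" "v = y + s b X0"
      by (auto simp: hyperplane_def)
    then have "u + v = (x + y) + s (a + b) X0" "x + y \<in> q"
      using q.carrier_closed(2) by (auto simp: V.scale_left_distrib algebra_simps)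
    then show "u + v \<in> hyperplane" using mem by simp
  next
    fix c u assume "u \<in> hyperplane"
    then obtain x a where "x \<in> q" "u = x + s a X0" by (auto simp: hyperplane_def)
    then have "s c u = s c x + s (c * a) X0" "s c x \<in> q"
      using q.carrier_closed(5) by (auto simp: V.scale_right_distrib)
    then show "s c u \<in> hyperplane" using mem by simp
  qed
  show "V = {x + s b Y0 | x b. x \<in> hyperplane}"
    unfolding carrier plane_sum_def hyperplane_def by blast
  show "Y0 \<notin> hyperplane"
  proof
    assume "Y0 \<in> hyperplane"
    then obtain x a where "x \<in> q" "Y0 = x + s a X0" by (auto simp: hyperplane_def)
    then show False using coordinates(1)[of x a 0] form_plane(4) by simp
  qed
  show "X0 \<notin> q" using form_plane(3,8) by auto
  show "q \<subseteq> hyperplane"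
  proof
    fix x assume "x \<in> q"
    then show "x \<in> hyperplane" using mem[of x 0] by simp
  qed
  show "hyperplane \<subseteq> V"
  proof
    fix x assume "x \<in> hyperplane"
    then show "x \<in> V" using in_V[of _ _ 0] by (auto simp: hyperplane_def)
  qed
qed

lemma ad_Y0_plane: "s t (br Y0 X0) = 0" "s t (br Y0 Y0) = 0"
  using ad_Y0[OF q.carrier_closed(1), of 1 0] ad_Y0[OF q.carrier_closed(1), of 0 1]
    q.linear_on_diff_zero(1)[OF V.vector_space_axioms C_linear(1)] by auto

end

lemma double_extension_spaceI:
  "double_extension s V br B X0 Y0 q C \<Longrightarrow> double_extension_space s V B q br X0 Y0 C"
  by (auto simp: double_extension_space_def double_extension_space_axioms_def double_extension_def)

lemma similar_on_cancel_plane: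
  assumes D: "double_extension s V br B X0 Y0 q C" and D': "double_extension s' V' br' B' X0' Y0' q' C'"
    and sim: "similar_on s V (\<lambda>z. s c (br Y0 z)) s' V' (\<lambda>z. s' d (br' Y0' z))"
  shows "similar_on s q (\<lambda>x. s c (C x)) s' q' (\<lambda>x. s' d (C' x))"
proof -
  interpret D: double_extension_space s V B q br X0 Y0 C using D by (rule double_extension_spaceI)
  interpret D': double_extension_space s' V' B' q' br' X0' Y0' C' using D' by (rule double_extension_spaceI)
  note vs = D.V.vector_space_axioms D'.V.vector_space_axioms
  note H = D.hyperplane_facts and H' = D'.hyperplane_facts
  have st: "(\<lambda>z. s c (br Y0 z)) ` U \<subseteq> q" if "U \<subseteq> V" for U
    using D.linear_ad_Y0(2) that by blast
  have st': "(\<lambda>z. s' d (br' Y0' z)) ` U \<subseteq> q'" if "U \<subseteq> V'" for U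
    using D'.linear_ad_Y0(2) that by blast
  have "similar_on s D.hyperplane (\<lambda>z. s c (br Y0 z)) s' D'.hyperplane (\<lambda>z. s' d (br' Y0' z))"
    using similar_on_cancel_line[OF vs H(1) H'(1) H(2,3) H'(2,3) D.linear_ad_Y0(1) _ D.ad_Y0_plane(2)
        D'.linear_ad_Y0(1) _ D'.ad_Y0_plane(2) sim]
      order_trans[OF st[OF H(6)] H(5)] order_trans[OF st'[OF H'(6)] H'(5)] by blast
  then have "similar_on s q (\<lambda>z. s c (br Y0 z)) s' q' (\<lambda>z. s' d (br' Y0' z))"
    using similar_on_cancel_line[OF vs D.q.subspace_carrier D'.q.subspace_carrier D.hyperplane_def H(4)
        D'.hyperplane_def H'(4) linear_on_subset[OF D.linear_ad_Y0(1) H(6)] _ D.ad_Y0_plane(1)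
        linear_on_subset[OF D'.linear_ad_Y0(1) H'(6)] _ D'.ad_Y0_plane(1)]
      st[OF order_trans[OF H(5,6)]] st'[OF order_trans[OF H'(5,6)]] by blast
  then show ?thesis by (rule similar_on_cong) (simp_all add: D.ad_Y0_q D'.ad_Y0_q)
qed

text \<open>A Lie isomorphism \<open>f\<close> need not map the line of \<open>X0\<close> to that of \<open>X0'\<close>, so it cannot be compared
  directly with the two decompositions. However, the kernels of two nonzero functionals do not cover
  the space: there is a \<open>Z\<close> lying outside the hyperplane orthogonal to \<open>X0\<close> whose
  image lies outside the one orthogonal to \<open>X0'\<close>, and its adjoint operator determines both \<open>C\<close> and
  \<open>C'\<close> up to similarity and a factor.\<close>

lemma lie_isomorphic_imp_similar:
  assumes D: "double_extension s V br B X0 Y0 q C" and D': "double_extension s' V' br' B' X0' Y0' q' C'"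
    and iso: "lie_isomorphic s V br s' V' br'"
  shows "\<exists>t. t \<noteq> 0 \<and> similar_on s q C s' q' (\<lambda>x. s' t (C' x))"
proof -
  interpret D: double_extension_space s V B q br X0 Y0 C using D by (rule double_extension_spaceI)
  interpret D': double_extension_space s' V' B' q' br' X0' Y0' C' using D' by (rule double_extension_spaceI)
  obtain f where f: "linear_on s s' V f" "bij_betw f V V'"
      "\<And>x y. x \<in> V \<Longrightarrow> y \<in> V \<Longrightarrow> f (br x y) = br' (f x) (f y)"
    using iso by (auto simp: lie_isomorphic_def lie_isomorphism_def)
  have im: "f ` V = V'" using f(2) by (simp add: bij_betw_def)
  have fV: "f z \<in> V'" if "z \<in> V" for z using im that by blast
  obtain Z where Z: "Z \<in> V" "B Z X0 \<noteq> 0" "B' (f Z) X0' \<noteq> 0"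
  proof -
    obtain W where W: "W \<in> V" "f W = Y0'" using im D'.plane_in_V(2) by blast
    consider "B' (f Y0) X0' \<noteq> 0" | "B W X0 \<noteq> 0" | "B' (f Y0) X0' = 0" "B W X0 = 0" by blast
    then show ?thesis
    proof cases
      case 1
      then show ?thesis using that[of Y0] D.plane_in_V D.form_plane(4) by simp
    next
      case 2
      then show ?thesis using that[of W] W D'.form_plane(4) by simp
    next
      case 3
      have "f (Y0 + W) = f Y0 + Y0'" using linear_onD(1)[OF f(1)] D.plane_in_V(2) W by simp
      moreover have "B (Y0 + W) X0 = 1" "B' (f Y0 + Y0') X0' = 1"
        using 3 W D.plane_in_V D'.plane_in_V fV
        by (simp_all add: D.B_linear D'.B_linear D.form_plane D'.form_plane)
      ultimately show ?thesis
        using that[of "Y0 + W"] D.V.carrier_closed(2)[OF D.plane_in_V(2) W(1)] by simp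
    qed
  qed
  define m m' where "m = B Z X0" and "m' = B' (f Z) X0'"
  have m: "m \<noteq> 0" "m' \<noteq> 0" using Z by (auto simp: m_def m'_def)
  have "similar_on s V (\<lambda>z. s m (br Y0 z)) s V (br Z)"
    unfolding m_def by (rule D.ad_similar[OF Z(1,2)])
  also have "similar_on s V (br Z) s' V' (br' (f Z))"
    unfolding similar_on_def by (intro exI[of _ f] conjI ballI f(1,2) f(3)[OF Z(1)])
  also have "similar_on s' V' (br' (f Z)) s' V' (\<lambda>z. s' m' (br' Y0' z))"
    unfolding m'_def
  proof (rule similar_on_sym[OF D'.V.fin_dim_space_axioms _ D'.ad_similar[OF fV[OF Z(1)] Z(3)]])
    show "(\<lambda>z. s' (B' (f Z) X0') (br' Y0' z)) ` V' \<subseteq> V'"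
      using order_trans[OF D'.linear_ad_Y0(2)] D'.q_in_V by blast
  qed
  finally have "similar_on s q (\<lambda>x. s m (C x)) s' q' (\<lambda>x. s' m' (C' x))"
    by (rule similar_on_cancel_plane[OF D D'])
  then have "similar_on s q (\<lambda>x. s (1 / m) (s m (C x))) s' q' (\<lambda>x. s' (1 / m) (s' m' (C' x)))"
    by (rule similar_on_scale) (use D.C_linear(3) D.q.carrier_closed(5) in blast)
  then have "similar_on s q C s' q' (\<lambda>x. s' (m' / m) (C' x))" using m by simp
  then show ?thesis using m by (intro exI[of _ "m' / m"]) simp
qed

text \<open>Conversely, an isometry \<open>A\<close> with \<open>A C = t C' A\<close> extends to an i-isomorphism by rescaling the
  hyperbolic plane: \<open>X0 \<mapsto> X0' / t\<close> and \<open>Y0 \<mapsto> t Y0'\<close>.\<close>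

lemma similar_imp_i_isomorphic:
  assumes D: "double_extension s V br B X0 Y0 q C" and D': "double_extension s' V' br' B' X0' Y0' q' C'"
    and t: "t \<noteq> 0" and sim: "similar_on s q C s' q' (\<lambda>x. s' t (C' x))"
  shows "i_isomorphic s V br B s' V' br' B'"
proof -
  interpret D: double_extension_space s V B q br X0 Y0 C using D by (rule double_extension_spaceI)
  interpret D': double_extension_space s' V' B' q' br' X0' Y0' C' using D' by (rule double_extension_spaceI)
  note Q = D.q.quadratic_space_axioms and Q' = D'.q.quadratic_space_axioms
  obtain A where A: "linear_on s s' q A" "bij_betw A q q'" "\<And>x. x \<in> q \<Longrightarrow> A (C x) = s' t (C' (A x))"
    "\<And>x y. x \<in> q \<Longrightarrow> y \<in> q \<Longrightarrow> B' (A x) (A y) = B x y"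
    using isometric_similarity[OF Q Q' D.skew skew_map_scale[OF Q' D'.skew] sim] by blast
  have imA: "A ` q = q'" using A(2) by (simp add: bij_betw_def)
  have Aq: "A x \<in> q'" if "x \<in> q" for x using imA that by blast
  define f where "f = (\<lambda>z. A (D.proj z) + s' (B z Y0 / t) X0' + s' (t * B z X0) Y0')"
  have f: "f (x + s l X0 + s m Y0) = A x + s' (l / t) X0' + s' (t * m) Y0'" if "x \<in> q" for x l m
    using that by (simp add: f_def D.coordinates)
  have isom: "B' (f z) (f w) = B z w" if zw: "z \<in> V" "w \<in> V" for z w
  proof -
    obtain x l m where x: "x \<in> q" and z: "z = x + s l X0 + s m Y0" using zw(1) by (rule D.decompose)
    obtain y l' m' where y: "y \<in> q" and w: "w = y + s l' X0 + s m' Y0" using zw(2) by (rule D.decompose)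
    show ?thesis
      unfolding z w f[OF x] f[OF y] D.form_coordinates[OF x y] D'.form_coordinates[OF Aq[OF x] Aq[OF y]]
      using t A(4)[OF x y] by simp
  qed
  have fV: "f z \<in> V'" if "z \<in> V" for z
    using that f D'.in_V Aq by (auto elim!: D.decompose)
  have "f (x + y) = f x + f y" if "x \<in> V" "y \<in> V" for x y
    using that D.plane_in_V D.proj_in linear_onD(1)[OF A(1)] linear_onD(1)[OF D.linear_proj]
    by (simp add: f_def D.B_linear D'.V.scale_left_distrib add_divide_distrib distrib_left algebra_simps)
  moreover have "f (s c x) = s' c (f x)" if "x \<in> V" for c x
    using that D.plane_in_V D.proj_in linear_onD(2)[OF A(1)] linear_onD(2)[OF D.linear_proj]
    by (simp add: f_def D.B_linear D'.V.scale_right_distrib mult.left_commute)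
  ultimately have lin: "linear_on s s' V f" by (simp add: linear_on_def)
  have "inj_on f V"
  proof (subst D.V.inj_on_linear_on_iff[OF D'.V.vector_space_axioms lin], intro ballI impI)
    fix z assume z: "z \<in> V" "f z = 0"
    show "z = 0"
    proof (rule D.V.form_nondegenerate[OF z(1)])
      fix w assume w: "w \<in> V"
      have "B' 0 (f w) = 0" using D'.B_linear(3)[of 0 "f w" 0] D'.V.carrier_closed(1) fV[OF w] by simp
      then show "B z w = 0" using isom[OF z(1) w] z(2) by simp
    qed
  qed
  moreover have "V' \<subseteq> f ` V"
  proof
    fix v assume "v \<in> V'"
    then obtain y l m where y: "y \<in> q'" and v: "v = y + s' l X0' + s' m Y0'" by (rule D'.decompose)
    obtain x where x: "x \<in> q" "y = A x" using imA y by blast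
    have "f (x + s (t * l) X0 + s (m / t) Y0) = v" using t by (simp add: f[OF x(1)] v x(2))
    then show "v \<in> f ` V" using D.in_V[OF x(1)] by blast
  qed
  ultimately have bij: "bij_betw f V V'" using fV by (auto simp: bij_betw_def)
  have hom: "f (br z w) = br' (f z) (f w)" if zw: "z \<in> V" "w \<in> V" for z w
  proof -
    obtain x l m where x: "x \<in> q" and z: "z = x + s l X0 + s m Y0" using zw(1) by (rule D.decompose)
    obtain y l' m' where y: "y \<in> q" and w: "w = y + s l' X0 + s m' Y0" using zw(2) by (rule D.decompose)
    let ?c = "s m (C y) - s m' (C x)"
    have smC: "s m (C y) \<in> q" "s m' (C x) \<in> q" using D.C_linear(3) D.q.carrier_closed(5) x y by auto
    have c: "?c \<in> q" using smC by (rule D.q.carrier_closed(3))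
    have "f (br z w) = f (?c + s (B (C x) y) X0 + s 0 Y0)"
      unfolding z w D.bracket[OF x y] by simp
    also have "\<dots> = A ?c + s' (B (C x) y / t) X0'" unfolding f[OF c] by simp
    also have "A ?c = s' m (A (C y)) - s' m' (A (C x))"
      using D.q.linear_on_diff_zero(2)[OF D'.V.vector_space_axioms A(1) smC] linear_onD(2)[OF A(1)]
        D.C_linear(3) x y by simp
    also have "\<dots> = s' (t * m) (C' (A y)) - s' (t * m') (C' (A x))"
      using A(3) x y by (simp add: mult.commute)
    also have "B (C x) y / t = B' (C' (A x)) (A y)"
      using A(4)[OF D.C_linear(3)[OF x] y] A(3)[OF x] t
        bilinear_onD(3)[OF D'.q.form_bilinear D'.C_linear(3)[OF Aq[OF x]] Aq[OF y]] by (simp add: field_simps)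
    also have "s' (t * m) (C' (A y)) - s' (t * m') (C' (A x)) + s' (B' (C' (A x)) (A y)) X0' = br' (f z) (f w)"
      unfolding z w f[OF x] f[OF y] by (rule D'.bracket[OF Aq[OF x] Aq[OF y], symmetric])
    finally show ?thesis .
  qed
  have "lie_isomorphism s V br s' V' br' f" using lin bij hom by (simp add: lie_isomorphism_def)
  then show ?thesis using isom unfolding i_isomorphic_def by (intro exI[of _ f]) simp
qed

lemma double_extension_isomorphic_iff:
  assumes D: "double_extension s V br B X0 Y0 q C" and D': "double_extension s' V' br' B' X0' Y0' q' C'"
  shows "lie_isomorphic s V br s' V' br'
      \<longleftrightarrow> (\<exists>t. t \<noteq> 0 \<and> similar_on s q C s' q' (\<lambda>x. s' t (C' x)))" (is "?L \<longleftrightarrow> ?S")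
    and "i_isomorphic s V br B s' V' br' B'
      \<longleftrightarrow> (\<exists>t. t \<noteq> 0 \<and> similar_on s q C s' q' (\<lambda>x. s' t (C' x)))" (is "?I \<longleftrightarrow> _")
proof -
  have "?I \<Longrightarrow> ?L" by (auto simp: i_isomorphic_def lie_isomorphic_def)
  moreover have "?L \<Longrightarrow> ?S" by (rule lie_isomorphic_imp_similar[OF D D'])
  moreover have "?S \<Longrightarrow> ?I" using similar_imp_i_isomorphic[OF D D'] by (elim exE conjE)
  ultimately show "?L \<longleftrightarrow> ?S" "?I \<longleftrightarrow> ?S" by iprover+
qed

theorem theorem5:
  fixes s :: "complex \<Rightarrow> 'a::ab_group_add \<Rightarrow> 'a" and g gN gI :: "'a set"
    and br :: "'a \<Rightarrow> 'a \<Rightarrow> 'a" and B :: "'a \<Rightarrow> 'a \<Rightarrow> complex"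
    and s' :: "complex \<Rightarrow> 'b::ab_group_add \<Rightarrow> 'b" and g' gN' gI' :: "'b set"
    and br' :: "'b \<Rightarrow> 'b \<Rightarrow> 'b" and B' :: "'b \<Rightarrow> 'b \<Rightarrow> complex"
  assumes "singular_quadratic_lie s g br B" and "solvable_lie s g br"
    and "fitting_components s g br B gN gI"
    and "singular_quadratic_lie s' g' br' B'" and "solvable_lie s' g' br'"
    and "fitting_components s' g' br' B' gN' gI'"
  shows "(i_isomorphic s g br B s' g' br' B' \<longleftrightarrow>
            i_isomorphic s gN br B s' gN' br' B' \<and> i_isomorphic s gI br B s' gI' br' B') \<and>
         (lie_isomorphic s g br s' g' br' \<longleftrightarrow>
            lie_isomorphic s gN br s' gN' br' \<and> lie_isomorphic s gI br s' gI' br')"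
proof -
  obtain X0 Y0 q C qN qI where D: "double_extension s g br B X0 Y0 q C"
    and F: "fitting_decomposition s q C qN qI"
    and gN: "gN = plane_sum s X0 Y0 qN" and gI: "gI = plane_sum s X0 Y0 qI"
    using assms(3) unfolding fitting_components_def by (elim exE conjE)
  obtain X0' Y0' q' C' qN' qI' where D': "double_extension s' g' br' B' X0' Y0' q' C'"
    and F': "fitting_decomposition s' q' C' qN' qI'"
    and gN': "gN' = plane_sum s' X0' Y0' qN'" and gI': "gI' = plane_sum s' X0' Y0' qI'"
    using assms(6) unfolding fitting_components_def by (elim exE conjE)
  interpret D: double_extension_space s g B q br X0 Y0 C using D by (rule double_extension_spaceI)
  interpret D': double_extension_space s' g' B' q' br' X0' Y0' C' using D' by (rule double_extension_spaceI)
  note DN = double_extension_nilpotent_part[OF D F, folded gN]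
    double_extension_nilpotent_part[OF D' F', folded gN']
  note DI = double_extension_invertible_part[OF D F, folded gI]
    double_extension_invertible_part[OF D' F', folded gI']
  show ?thesis
    unfolding double_extension_isomorphic_iff[OF D D'] double_extension_isomorphic_iff[OF DN]
      double_extension_isomorphic_iff[OF DI]
    using similar_up_to_scale_fitting_iff[OF D.q.fin_dim_space_axioms D.C_linear(1,2) F
        D'.q.fin_dim_space_axioms D'.C_linear(1,2) F'] by (intro conjI)
qed

end
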